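(* Let $(X,X_1)$ be a 2-stratifold and let $G(X,X_1)\subset X$ be (the geometric realization in $X$ of) its associated bipartite graph. Then there is a retraction $r:X\to G(X,X_1)$, i.e. a continuous map restricting to the identity on $G(X,X_1)$.
   Context: A 2-stratifold is a compact, connected Hausdorff space $X$ with a closed subspace $X_1\subset X$ such that $X_1$ is a closed 1-manifold (a finite disjoint union of circles), each point of $X_1$ has a neighborhood in $X$ homeomorphic to $\mathbb{R}\times CL$, where $CL$ is the open cone on a finite discrete set $L$ of cardinality $>2$ (with $X_1$ corresponding to $\mathbb{R}\times\{\text{cone point}\}$), and each point of $X\setminus X_1$ has a neighborhood homeomorphic to $\mathbb{R}^2$. Each component $C$ of $X_1$ has a regular neighborhood $N(C)=N_\pi(C):=(Y\times[0,1])/((y,1)\sim(h(y),0))$, where $Y$ is the closed cone on $\{1,\dots,d\}$ and $h:Y\to Y$ is a homeomorphism whose restriction to $\{1,\dots,d\}$ is a permutation $\pi$; only the conjugacy class of $\pi$ (a partition $n_1+\dots+n_s$ of $d$) matters. Equivalently, $N_\pi(C)$ is the mapping cylinder of the covering $\tilde C_1\sqcup\dots\sqcup\tilde C_s\to C$ whose restriction to the circle $\tilde C_i$ is an $n_i$-fold covering. Its boundary $\partial N_\pi(C)$ is the set of points having an open neighborhood homeomorphic to $\mathbb{R}\times[0,1)$. The neighborhoods $N(C)$ are chosen pairwise disjoint. The sheets of $N(C)$ are the closures of the components of $N(C)-C$. Let $M=\overline{X-\bigcup_j N(C_j)}$, where $C_j$ runs over the components of $X_1$; $M$ is a compact surface.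 Graph: $G(X,X_1)$ is the bipartite graph whose white vertices are the components $W_i$ of $M$, whose black vertices are the neighborhoods $N(C_j)$, and whose edges are the components $S$ of $\partial M$; the edge $S$ joins the white vertex $W_i$ to the black vertex $N(C_j)$ if $S$ is a component of $W_i\cap N(C_j)$. Geometric realization in $X$: choose a point $b_j\in C_j$ for each $j$, and a point $w_i$ in the interior of each $W_i$. For each component $S$ of $W_i\cap N(C_j)$ choose a point $y_S\in S$, an arc $\alpha_S$ in $W_i$ from $w_i$ to $y_S$ (meeting $\partial W_i$ only in $y_S$), and an arc $\beta_S$ from $y_S$ to $b_j$ in the sheet of $N(C_j)$ containing $y_S$ (meeting $\partial N(C_j)$ only in $y_S$). The arcs $\alpha_S$ in a fixed $W_i$ meet only at $w_i$, and the arcs $\beta_S$ in a fixed $N(C_j)$ meet only at $b_j$. The edge corresponding to $S$ is realized by the arc $\alpha_S*\beta_S$, and $G(X,X_1)\subset X$ is the union of all these vertices and edges. *)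

theory Defs
  imports "HOL-Analysis.Analysis" "HOL-Combinatorics.Permutations"
begin

section \<open>Quotient spaces, cones and mapping tori\<close>

text \<open>The points of the quotient space are the equivalence classes themselves.\<close>

definition quotient_topology :: "'a topology \<Rightarrow> ('a \<times> 'a) set \<Rightarrow> 'a set topology" where
  "quotient_topology X R =
     topology (\<lambda>U. U \<subseteq> topspace X // R \<and> openin X {x \<in> topspace X. R `` {x} \<in> U})"

lemma openin_quotient_topology:
  "openin (quotient_topology X R) U \<longleftrightarrow>
     U \<subseteq> topspace X // R \<and> openin X {x \<in> topspace X. R `` {x} \<in> U}"
proof -
  have Int: "{x \<in> topspace X. R `` {x} \<in> S \<inter> T} =
      {x \<in> topspace X. R `` {x} \<in> S} \<inter> {x \<in> topspace X. R `` {x} \<in> T}" for S T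
    by auto
  have Un: "{x \<in> topspace X. R `` {x} \<in> \<Union>\<K>} = (\<Union>K\<in>\<K>. {x \<in> topspace X. R `` {x} \<in> K})" for \<K>
    by auto
  have "istopology (\<lambda>U. U \<subseteq> topspace X // R \<and> openin X {x \<in> topspace X. R `` {x} \<in> U})"
    unfolding istopology_def Int Un by auto
  then show ?thesis
    unfolding quotient_topology_def by (simp only: topology_inverse')
qed

lemma topspace_quotient_topology: "topspace (quotient_topology X R) = topspace X // R"
proof -
  have "{x \<in> topspace X. R `` {x} \<in> topspace X // R} = topspace X"
    by (auto intro: quotientI)
  then have "openin (quotient_topology X R) (topspace X // R)"
    by (simp add: openin_quotient_topology)
  moreover have "topspace (quotient_topology X R) \<subseteq> topspace X // R"
    by (meson openin_quotient_topology openin_topspace)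
  ultimately show ?thesis
    by (simp add: openin_subset subset_antisym)
qed

text \<open>Identify all points of height \<open>0\<close> in \<open>L \<times> I\<close>.\<close>

definition cone_rel :: "nat set \<Rightarrow> real set \<Rightarrow> ((nat \<times> real) \<times> (nat \<times> real)) set" where
  "cone_rel L I = {(p, q). p \<in> L \<times> I \<and> q \<in> L \<times> I \<and> (p = q \<or> snd p = 0 \<and> snd q = 0)}"

definition cone_on :: "nat set \<Rightarrow> real set \<Rightarrow> (nat \<times> real) set topology" where
  "cone_on L I =
     quotient_topology (prod_topology (discrete_topology L) (top_of_set I)) (cone_rel L I)"

definition open_cone :: "nat set \<Rightarrow> (nat \<times> real) set topology" where
  "open_cone L = cone_on L {0..<1}"

definition closed_cone :: "nat set \<Rightarrow> (nat \<times> real) set topology" where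
  "closed_cone L = cone_on L {0..1}"

text \<open>The cone point is the class of all points of height \<open>0\<close>; the element \<open>i\<close> of \<open>L\<close>
  sits in the closed cone as the class of \<open>(i, 1)\<close>, a singleton.\<close>

definition cone_point :: "nat set \<Rightarrow> (nat \<times> real) set" where
  "cone_point L = L \<times> {0}"

definition base_point :: "nat \<Rightarrow> (nat \<times> real) set" where
  "base_point i = {(i, 1)}"

lemma equiv_cone_rel: "equiv (L \<times> I) (cone_rel L I)"
  by (rule equivI) (auto simp: cone_rel_def refl_on_def sym_def trans_def)

lemma cone_classes:
  assumes "i \<in> L"
  shows "cone_rel L {0..<1} `` {(i, 0)} = cone_point L"
    and "cone_rel L {0..1} `` {(i, 0)} = cone_point L"
    and "cone_rel L {0..1} `` {(i, 1)} = base_point i"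
  using assms by (auto simp: cone_rel_def cone_point_def base_point_def)

text \<open>The gluing \<open>(y, 1) \<sim> (h y, 0)\<close> of \<open>Y \<times> [0, 1]\<close>.\<close>

definition torus_rel :: "'a topology \<Rightarrow> ('a \<Rightarrow> 'a) \<Rightarrow> (('a \<times> real) \<times> ('a \<times> real)) set" where
  "torus_rel Y h =
     (let r = {((y, 1), (h y, 0)) | y. y \<in> topspace Y}
      in Id_on (topspace Y \<times> {0..1}) \<union> r \<union> r\<inverse>)"

definition mapping_torus :: "'a topology \<Rightarrow> ('a \<Rightarrow> 'a) \<Rightarrow> ('a \<times> real) set topology" where
  "mapping_torus Y h =
     quotient_topology (prod_topology Y (top_of_set {0..1})) (torus_rel Y h)"

lemma equiv_torus_rel:
  assumes "homeomorphic_map Y Y h"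
  shows "equiv (topspace Y \<times> {0..1}) (torus_rel Y h)"
proof -
  have h: "h ` topspace Y = topspace Y" "inj_on h (topspace Y)"
    by (rule homeomorphic_imp_surjective_map[OF assms], rule homeomorphic_imp_injective_map[OF assms])
  have h_in: "h y \<in> topspace Y" if "y \<in> topspace Y" for y
    using h(1) that by blast
  have mem: "(p, q) \<in> torus_rel Y h \<longleftrightarrow> p \<in> topspace Y \<times> {0..1} \<and> q \<in> topspace Y \<times> {0..1} \<and>
      (p = q \<or> (snd p = 1 \<and> q = (h (fst p), 0)) \<or> (snd q = 1 \<and> p = (h (fst q), 0)))" for p q
    using h_in by (cases p; cases q) (auto simp: torus_rel_def Let_def)
  show ?thesis
  proof (rule equivI)
    show "torus_rel Y h \<subseteq> (topspace Y \<times> {0..1}) \<times> (topspace Y \<times> {0..1})"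
    proof (rule subrelI)
      fix p q assume "(p, q) \<in> torus_rel Y h"
      then show "(p, q) \<in> (topspace Y \<times> {0..1}) \<times> (topspace Y \<times> {0..1})"
        unfolding mem by (intro SigmaI) (elim conjE, assumption)+
    qed
    show "refl_on (topspace Y \<times> {0..1}) (torus_rel Y h)"
      by (rule refl_onI) (simp only: mem simp_thms)
    show "sym (torus_rel Y h)"
    proof (rule symI)
      fix p q assume "(p, q) \<in> torus_rel Y h"
      then show "(q, p) \<in> torus_rel Y h"
        unfolding mem by (elim conjE disjE) simp_all
    qed
    show "trans (torus_rel Y h)"
    proof (rule transI)
      fix p q r
      assume pq: "(p, q) \<in> torus_rel Y h" and qr: "(q, r) \<in> torus_rel Y h"
      have inj: "p = r" if "snd p = 1" "snd r = 1" "h (fst p) = h (fst r)"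
      proof -
        have "fst p \<in> topspace Y" "fst r \<in> topspace Y"
          using pq qr unfolding mem by (simp_all add: mem_Times_iff)
        then have "fst p = fst r"
          using that(3) h(2) by (simp add: inj_on_eq_iff)
        then show ?thesis using that by (simp add: prod_eq_iff)
      qed
      show "(p, r) \<in> torus_rel Y h"
        using pq qr inj unfolding mem by (metis prod.inject snd_conv zero_neq_one)
    qed
  qed
qed


section \<open>2-stratifolds\<close>

definition neighbourhood_of :: "'a topology \<Rightarrow> 'a \<Rightarrow> 'a set \<Rightarrow> bool" where
  "neighbourhood_of X x U \<longleftrightarrow> U \<subseteq> topspace X \<and> x \<in> X interior_of U"

definition components_in :: "'a topology \<Rightarrow> 'a set \<Rightarrow> 'a set set" where
  "components_in X A = connected_components_of (subtopology X A)"

definition closed_1_manifold :: "'a topology \<Rightarrow> bool" where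
  "closed_1_manifold Z \<longleftrightarrow>
     finite (connected_components_of Z) \<and>
     (\<forall>C \<in> connected_components_of Z.
        subtopology Z C homeomorphic_space top_of_set (sphere (0::complex) 1))"

definition two_stratifold :: "'a topology \<Rightarrow> 'a set \<Rightarrow> bool" where
  "two_stratifold X X1 \<longleftrightarrow>
     compact_space X \<and> connected_space X \<and> Hausdorff_space X \<and>
     closedin X X1 \<and> closed_1_manifold (subtopology X X1) \<and>
     (\<forall>x \<in> X1. \<exists>U L f. neighbourhood_of X x U \<and> finite L \<and> card L > 2 \<and>
        homeomorphic_map (subtopology X U) (prod_topology euclideanreal (open_cone L)) f \<and>
        f ` (U \<inter> X1) = UNIV \<times> {cone_point L}) \<and>
     (\<forall>x \<in> topspace X - X1. \<exists>U. neighbourhood_of X x U \<and>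
        subtopology X U homeomorphic_space (euclidean :: (real \<times> real) topology))"


section \<open>Regular neighbourhoods of the singular curves\<close>

text \<open>\<open>regular_neighbourhood X C N\<close>: \<open>N\<close> is a neighbourhood of \<open>C\<close> in \<open>X\<close> and a copy of the
  mapping torus of a homeomorphism of the closed cone on \<open>{1..d}\<close>, in which \<open>C\<close> is the core,
  i.e. the image of \<open>cone point \<times> [0, 1]\<close>.\<close>

definition regular_neighbourhood :: "'a topology \<Rightarrow> 'a set \<Rightarrow> 'a set \<Rightarrow> bool" where
  "regular_neighbourhood X C N \<longleftrightarrow>
     N \<subseteq> topspace X \<and> C \<subseteq> X interior_of N \<and>
     (\<exists>d h \<pi> \<phi>. let L = {1..d}; Y = closed_cone L in
        homeomorphic_map Y Y h \<and>
        \<pi> permutes L \<and> (\<forall>i\<in>L. h (base_point i) = base_point (\<pi> i)) \<and>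
        homeomorphic_map (mapping_torus Y h) (subtopology X N) \<phi> \<and>
        \<phi> ` ((\<lambda>t. torus_rel Y h `` {(cone_point L, t)}) ` {0..1}) = C)"

definition regular_neighbourhoods ::
    "'a topology \<Rightarrow> 'a set \<Rightarrow> ('a set \<Rightarrow> 'a set) \<Rightarrow> bool" where
  "regular_neighbourhoods X X1 N \<longleftrightarrow>
     (\<forall>C \<in> components_in X X1. regular_neighbourhood X C (N C)) \<and>
     (\<forall>C \<in> components_in X X1. \<forall>C' \<in> components_in X X1. C \<noteq> C' \<longrightarrow> N C \<inter> N C' = {})"

text \<open>The boundary of \<open>N(C)\<close>: the points with an open neighbourhood \<open>\<real> \<times> [0, 1)\<close>, where the
  point itself must lie on \<open>\<real> \<times> {0}\<close>.\<close>

definition nbhd_boundary :: "'a topology \<Rightarrow> 'a set \<Rightarrow> 'a set" where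
  "nbhd_boundary X N =
     {x \<in> N. \<exists>U f. openin (subtopology X N) U \<and> x \<in> U \<and>
        homeomorphic_map (subtopology X U) (prod_topology euclideanreal (top_of_set {0..<1::real})) f \<and>
        snd (f x) = 0}"

definition sheets :: "'a topology \<Rightarrow> 'a set \<Rightarrow> 'a set \<Rightarrow> 'a set set" where
  "sheets X C N = (\<lambda>K. X closure_of K) ` components_in X (N - C)"


section \<open>The complementary surface\<close>

definition complementary_surface ::
    "'a topology \<Rightarrow> 'a set \<Rightarrow> ('a set \<Rightarrow> 'a set) \<Rightarrow> 'a set" where
  "complementary_surface X X1 N = X closure_of (topspace X - (\<Union>C \<in> components_in X X1. N C))"

text \<open>Interior and boundary in the sense of 2-manifolds, computed in the subspace \<open>W\<close> alone.\<close>

definition surface_interior :: "'a topology \<Rightarrow> 'a set \<Rightarrow> 'a set" where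
  "surface_interior X W =
     {x \<in> W. \<exists>U. openin (subtopology X W) U \<and> x \<in> U \<and>
        subtopology X U homeomorphic_space (euclidean :: (real \<times> real) topology)}"

definition surface_boundary :: "'a topology \<Rightarrow> 'a set \<Rightarrow> 'a set" where
  "surface_boundary X W = W - surface_interior X W"


section \<open>The graph and its geometric realization\<close>

definition white_vertices :: "'a topology \<Rightarrow> 'a set \<Rightarrow> ('a set \<Rightarrow> 'a set) \<Rightarrow> 'a set set" where
  "white_vertices X X1 N = components_in X (complementary_surface X X1 N)"

definition edges :: "'a topology \<Rightarrow> 'a set \<Rightarrow> ('a set \<Rightarrow> 'a set) \<Rightarrow> 'a set set" where
  "edges X X1 N = components_in X (surface_boundary X (complementary_surface X X1 N))"

definition joins :: "'a topology \<Rightarrow> 'a set \<Rightarrow> 'a set \<Rightarrow> 'a set \<Rightarrow> bool" where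
  "joins X S W B \<longleftrightarrow> S \<in> components_in X (W \<inter> B)"

definition arc_from_to :: "'a topology \<Rightarrow> 'a set \<Rightarrow> 'a \<Rightarrow> 'a \<Rightarrow> bool" where
  "arc_from_to X A p q \<longleftrightarrow>
     (\<exists>g. embedding_map (top_of_set {0..1::real}) X g \<and> g ` {0..1} = A \<and> g 0 = p \<and> g 1 = q)"

text \<open>The vertices are the components \<open>W\<close> of the complementary surface (white) and the sets
  \<open>N C\<close> (black), the latter indexed by \<open>C\<close>. An edge \<open>S\<close> determines its
  end vertices, so the choices \<open>y\<close>, \<open>\<alpha>\<close>, \<open>\<beta>\<close> are indexed by \<open>S\<close> alone. Arcs are given by their point sets.\<close>

definition realization_data ::
    "'a topology \<Rightarrow> 'a set \<Rightarrow> ('a set \<Rightarrow> 'a set) \<Rightarrow>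
     ('a set \<Rightarrow> 'a) \<Rightarrow> ('a set \<Rightarrow> 'a) \<Rightarrow> ('a set \<Rightarrow> 'a) \<Rightarrow>
     ('a set \<Rightarrow> 'a set) \<Rightarrow> ('a set \<Rightarrow> 'a set) \<Rightarrow> bool" where
  "realization_data X X1 N w b y \<alpha> \<beta> \<longleftrightarrow>
     (\<forall>C \<in> components_in X X1. b C \<in> C) \<and>
     (\<forall>W \<in> white_vertices X X1 N. w W \<in> surface_interior X W) \<and>
     (\<forall>W \<in> white_vertices X X1 N. \<forall>C \<in> components_in X X1. \<forall>S \<in> edges X X1 N.
        joins X S W (N C) \<longrightarrow>
        y S \<in> S \<and>
        arc_from_to X (\<alpha> S) (w W) (y S) \<and> \<alpha> S \<subseteq> W \<and> \<alpha> S \<inter> surface_boundary X W = {y S} \<and>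
        arc_from_to X (\<beta> S) (y S) (b C) \<and> (\<exists>D \<in> sheets X C (N C). y S \<in> D \<and> \<beta> S \<subseteq> D) \<and>
        \<beta> S \<inter> nbhd_boundary X (N C) = {y S}) \<and>
     (\<forall>W \<in> white_vertices X X1 N. \<forall>S \<in> edges X X1 N. \<forall>S' \<in> edges X X1 N.
        S \<subseteq> W \<and> S' \<subseteq> W \<and> S \<noteq> S' \<longrightarrow> \<alpha> S \<inter> \<alpha> S' = {w W}) \<and>
     (\<forall>C \<in> components_in X X1. \<forall>S \<in> edges X X1 N. \<forall>S' \<in> edges X X1 N.
        S \<subseteq> N C \<and> S' \<subseteq> N C \<and> S \<noteq> S' \<longrightarrow> \<beta> S \<inter> \<beta> S' = {b C})"

definition realized_graph ::
    "'a topology \<Rightarrow> 'a set \<Rightarrow> ('a set \<Rightarrow> 'a set) \<Rightarrow>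
     ('a set \<Rightarrow> 'a) \<Rightarrow> ('a set \<Rightarrow> 'a) \<Rightarrow> ('a set \<Rightarrow> 'a set) \<Rightarrow> ('a set \<Rightarrow> 'a set) \<Rightarrow> 'a set" where
  "realized_graph X X1 N w b \<alpha> \<beta> =
     w ` white_vertices X X1 N \<union> b ` components_in X X1 \<union> (\<Union>S \<in> edges X X1 N. \<alpha> S \<union> \<beta> S)"

end

theory Submission
  imports Defs
begin

text \<open>
  The regular neighbourhoods \<open>N C\<close> and the components \<open>W\<close> of the complementary surface \<open>M\<close> form a
  finite closed cover of \<open>X\<close> in which a \<open>W\<close> and an \<open>N C\<close> meet only in edges \<open>S\<close>, that is, in
  components of \<open>\<partial>M\<close>. In each \<open>W\<close> the graph is a star of arcs \<open>\<alpha> S\<close> emanating from \<open>w W\<close>, and in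
  each \<open>N C\<close> it is a star of arcs \<open>\<beta> S\<close> emanating from \<open>b C\<close>; either star meets an edge \<open>S\<close> in the
  single point \<open>y S\<close>. A star is an absolute retract, so each piece retracts onto its star by a map
  that collapses every \<open>S\<close> to \<open>y S\<close> (\<open>star_retraction\<close>). These retractions agree on the edges
  and glue to a retraction of \<open>X\<close> onto the graph.

  Most of the work goes into showing that the pieces do meet in this way. The key fact is that
  the frontier of \<open>N C\<close> in \<open>X\<close> is the image of \<open>{1..d} \<times> [0, 1]\<close> in the mapping torus, where
  \<open>{1..d}\<close> is the base of the cone (\<open>regular_neighbourhood_structure\<close>,
  \<open>regular_neighbourhood_frontier\<close>). This rests on charts of the mapping torus: every point of it
  has a neighbourhood of the form \<open>Y \<times> \<real>\<close> (\<open>mapping_torus_chart\<close>). Away from the core and the base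
  these charts are open discs, whose image is open in \<open>X\<close> by invariance of domain; at the base
  they are half discs, and invariance of domain shows that their boundary points are not interior
  to \<open>N C\<close>. Three consequences follow.

  \<^item> The boundary of \<open>M\<close>, and of each of its components, defined intrinsically as the set of
    points without a planar neighbourhood, is exactly the part lying on the frontiers of the \<open>N C\<close>
    (\<open>surface_boundary_eq\<close>). Hence every edge is a component of \<open>W \<inter> N C\<close> for a unique \<open>W\<close> and \<open>C\<close>,
    which is what the conditions on the arcs presuppose.
  \<^item> The boundary of \<open>M\<close> is a finite union of connected sets, so there are finitely many edges.
  \<^item> Since \<open>X\<close> is connected, the boundary bumping theorem makes every component of a proper \<open>M\<close>
    contain an edge, so there are finitely many components, and the cover is finite.
\<close>

section \<open>Retractions onto stars\<close>

lemma arc_parameter: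
  assumes "embedding_map (top_of_set {0..1::real}) X g"
  obtains k where "continuous_map (subtopology X (g ` {0..1})) (top_of_set {0..1}) k"
    "\<And>t. t \<in> {0..1} \<Longrightarrow> k (g t) = t"
proof -
  have "homeomorphic_map (top_of_set {0..1}) (subtopology X (g ` {0..1})) g"
    using assms by (simp add: embedding_map_def)
  then obtain k where "homeomorphic_maps (top_of_set {0..1}) (subtopology X (g ` {0..1})) g k"
    using homeomorphic_map_maps by blast
  then show thesis
    by (intro that[of k]) (auto simp: homeomorphic_maps_def)
qed

lemma arc_from_to_reverse:
  assumes "arc_from_to X A p q"
  shows "arc_from_to X A q p"
proof -
  obtain g where g: "embedding_map (top_of_set {0..1::real}) X g" "g ` {0..1} = A" "g 0 = p" "g 1 = q"
    using assms by (auto simp: arc_from_to_def)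
  have "homeomorphic_maps (top_of_set {0..1}) (top_of_set {0..1}) (\<lambda>t::real. 1 - t) (\<lambda>t. 1 - t)"
    by (auto simp: homeomorphic_maps_def intro!: continuous_intros)
  then have "embedding_map (top_of_set {0..1}) (top_of_set {0..1}) (\<lambda>t::real. 1 - t)"
    using homeomorphic_map_maps surjective_embedding_map by blast
  then have "embedding_map (top_of_set {0..1}) X (g \<circ> (\<lambda>t. 1 - t))"
    using g(1) by (rule embedding_map_compose)
  moreover have "(\<lambda>t::real. 1 - t) ` {0..1} = {0..1}"
    by simp
  then have "(g \<circ> (\<lambda>t. 1 - t)) ` {0..1} = A"
    using g(2) by (metis image_comp)
  ultimately show ?thesis
    unfolding arc_from_to_def using g(3,4) by (intro exI[of _ "g \<circ> (\<lambda>t. 1 - t)"]) auto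
qed

text \<open>
  The sets \<open>T S\<close> are the closed sets to be collapsed. Tietze's theorem extends the parameter of each
  arc to a function \<open>u S\<close> on \<open>K\<close> that is \<open>1\<close> on \<open>T S\<close> and vanishes on all other arcs and sets. Together
  the \<open>u S\<close> map \<open>K\<close> to the cube \<open>[0, 1]\<^sup>E\<close>, and the star is a copy of the union of the coordinate axes
  of the cube. The cube retracts onto the axes by replacing each coordinate by the positive part
  of its excess over the sum of the others: at most one coordinate can have a positive excess.
\<close>
lemma star_retraction:
  fixes K :: "'a topology" and A T :: "'i \<Rightarrow> 'a set" and y :: "'i \<Rightarrow> 'a"
  assumes K: "compact_space K" "Hausdorff_space K" and E: "finite E" and c: "c \<in> topspace K"
    and arc: "\<And>S. S \<in> E \<Longrightarrow> arc_from_to K (A S) c (y S)"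
    and T: "\<And>S. S \<in> E \<Longrightarrow> closedin K (T S)"
    and AT: "\<And>S. S \<in> E \<Longrightarrow> A S \<inter> T S = {y S}"
    and AA: "\<And>S S'. S \<in> E \<Longrightarrow> S' \<in> E \<Longrightarrow> S \<noteq> S' \<Longrightarrow> A S \<inter> A S' = {c}"
    and AT': "\<And>S S'. S \<in> E \<Longrightarrow> S' \<in> E \<Longrightarrow> S \<noteq> S' \<Longrightarrow> A S \<inter> T S' = {}"
    and TT: "\<And>S S'. S \<in> E \<Longrightarrow> S' \<in> E \<Longrightarrow> S \<noteq> S' \<Longrightarrow> T S \<inter> T S' = {}"
  obtains r where "continuous_map K K r" "r ` topspace K \<subseteq> insert c (\<Union>(A ` E))"
    "\<And>x. x \<in> insert c (\<Union>(A ` E)) \<Longrightarrow> r x = x"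
    "\<And>S x. S \<in> E \<Longrightarrow> x \<in> T S \<Longrightarrow> r x = y S"
proof (cases "E = {}")
  case True
  then show thesis
    using c by (intro that[of "\<lambda>_. c"]) auto
next
  case False
  have "\<exists>g. embedding_map (top_of_set {0..1::real}) K g \<and> g ` {0..1} = A S \<and> g 0 = c \<and> g 1 = y S"
    if "S \<in> E" for S
    using arc[OF that] by (simp add: arc_from_to_def)
  then obtain g where g: "\<And>S. S \<in> E \<Longrightarrow> embedding_map (top_of_set {0..1::real}) K (g S)"
      "\<And>S. S \<in> E \<Longrightarrow> g S ` {0..1} = A S" "\<And>S. S \<in> E \<Longrightarrow> g S 0 = c" "\<And>S. S \<in> E \<Longrightarrow> g S 1 = y S"
    by metis
  have contg: "continuous_map (top_of_set {0..1}) K (g S)" if "S \<in> E" for S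
    using g(1)[OF that] by (auto simp: embedding_map_def continuous_map_in_subtopology
        dest: homeomorphic_imp_continuous_map)
  have cA: "c \<in> A S" if "S \<in> E" for S
  proof -
    have "g S 0 \<in> g S ` {0..1}" by (intro imageI) auto
    then show ?thesis using g(2,3) that by simp
  qed
  have clA: "closedin K (A S)" if "S \<in> E" for S
  proof (rule compactin_imp_closedin[OF K(2)])
    have "compactin (top_of_set {0..1::real}) {0..1}"
      by (simp add: compactin_subtopology)
    then show "compactin K (A S)"
      using image_compactin[OF _ contg[OF that]] g(2)[OF that] by metis
  qed
  define param where "param S v \<longleftrightarrow> continuous_map K euclideanreal v \<and> v ` topspace K \<subseteq> {0..1} \<and>
        (\<forall>t\<in>{0..1}. v (g S t) = t) \<and> (\<forall>x\<in>T S. v x = 1) \<and>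
        (\<forall>S'\<in>E - {S}. \<forall>x \<in> A S' \<union> T S'. v x = 0)" for S v
  have ex_param: "\<exists>u. param S u" if S: "S \<in> E" for S
  proof -
    obtain k where k: "continuous_map (subtopology K (g S ` {0..1})) (top_of_set {0..1}) k"
        "\<And>t. t \<in> {0..1} \<Longrightarrow> k (g S t) = t"
      using arc_parameter[OF g(1)[OF S]] by metis
    \<comment> \<open>the closed set on which the parameter of \<open>S\<close> has to vanish\<close>
    define Q where "Q = (\<Union>S'\<in>E - {S}. A S' \<union> T S')"
    have clQ: "closedin K Q"
      unfolding Q_def using E T clA by (intro closedin_Union) auto
    let ?D = "\<lambda>j::nat. if j = 0 then A S else if j = 1 then T S else Q"
    let ?f = "\<lambda>j::nat. if j = 0 then k else if j = 1 then (\<lambda>_. 1) else (\<lambda>_. 0)"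
    have AQ: "A S \<inter> Q \<subseteq> {c}" "T S \<inter> Q = {}"
      using AA[OF S] AT'[OF S] TT[OF S] AT'[OF _ S] unfolding Q_def by blast+
    have kc: "k c = 0" and ky: "k (y S) = 1"
      using k(2)[of 0] k(2)[of 1] g(3,4)[OF S] by auto
    define Z where "Z = A S \<union> T S \<union> Q"
    have Zsub: "Z \<subseteq> topspace K"
      unfolding Z_def using clA[OF S] T[OF S] clQ by (simp add: closedin_subset)
    have clZ: "closedin K Z" unfolding Z_def using clA[OF S] T[OF S] clQ by auto
    obtain v where v: "continuous_map (subtopology K Z) euclideanreal v"
      "\<And>x j. \<lbrakk>j \<in> {0,1,2}; x \<in> topspace (subtopology K Z) \<inter> ?D j\<rbrakk> \<Longrightarrow> v x = ?f j x"
    proof (rule pasting_lemma_exists_closed[of "{0,1,2}" "subtopology K Z" ?D euclideanreal ?f])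
      show "topspace (subtopology K Z) \<subseteq> \<Union> (?D ` {0, 1, 2})"
        by (auto simp: Z_def)
      show "closedin (subtopology K Z) (?D j)" if "j \<in> {0,1,2}" for j
        by (rule closedin_subset_topspace) (use clA[OF S] T[OF S] clQ in \<open>auto simp: Z_def\<close>)
      show "continuous_map (subtopology (subtopology K Z) (?D j)) euclideanreal (?f j)"
        if "j \<in> {0,1,2}" for j
      proof (cases "j = 0")
        case True
        have "continuous_map (subtopology K (A S)) euclideanreal k"
          using k(1) g(2)[OF S] continuous_map_into_fulltopology by metis
        moreover have "Z \<inter> A S = A S" by (auto simp: Z_def)
        ultimately show ?thesis using True
          by (simp add: subtopology_subtopology)
      qed auto
      show "?f i x = ?f j x"
        if "i \<in> {0,1,2}" "j \<in> {0,1,2}" "x \<in> topspace (subtopology K Z) \<inter> ?D i \<inter> ?D j" for i j x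
      proof -
        have "k x = 1" if "x \<in> A S" "x \<in> T S"
          using that AT[OF S] ky by (metis IntI singletonD)
        moreover have "k x = 0" if "x \<in> A S" "x \<in> Q"
          using that AQ(1) kc by blast
        ultimately show ?thesis
          using that AQ(2) by (auto split: if_splits)
      qed
    qed auto
    have vA: "v x = k x" if "x \<in> A S" for x using v(2)[of 0 x] that Zsub by (auto simp: Z_def)
    have vT: "v x = 1" if "x \<in> T S" for x using v(2)[of 1 x] that Zsub by (auto simp: Z_def)
    have vQ: "v x = 0" if "x \<in> Q" for x using v(2)[of 2 x] that Zsub by (auto simp: Z_def)
    have kim: "k x \<in> {0..1}" if "x \<in> A S" for x
    proof -
      have "x \<in> g S ` {0..1}" using that g(2)[OF S] by simp
      then obtain t where "x = g S t" "t \<in> {0..1}" by (rule imageE)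
      then show ?thesis using k(2)[of t] by simp
    qed
    have "v ` Z \<subseteq> {0..1}"
      using vA vT vQ kim unfolding Z_def by auto
    then obtain u where u: "continuous_map K euclideanreal u"
        "\<And>x. x \<in> Z \<Longrightarrow> u x = v x" "u ` topspace K \<subseteq> {0..1}"
      using Tietze_extension_closed_real_interval[OF _ clZ v(1), of 0 1] K
      by (metis compact_Hausdorff_or_regular_imp_normal_space zero_le_one)
    show ?thesis unfolding param_def
    proof (intro exI[of _ u] conjI ballI)
      fix t :: real assume t: "t \<in> {0..1}"
      then have "g S t \<in> A S" using g(2)[OF S] by (metis imageI)
      then show "u (g S t) = t" using u(2) vA k(2)[OF t] by (simp add: Z_def)
    next
      fix x assume "x \<in> T S" then show "u x = 1" using u(2) vT by (simp add: Z_def)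
    next
      fix S' x assume "S' \<in> E - {S}" "x \<in> A S' \<union> T S'"
      then have "x \<in> Q" unfolding Q_def by blast
      then show "u x = 0" using u(2) vQ by (simp add: Z_def)
    qed (use u in auto)
  qed
  define u where "u S = (SOME v. param S v)" for S
  have param_u: "param S (u S)" if "S \<in> E" for S
    using someI_ex[OF ex_param[OF that]] by (simp add: u_def)
  have u: "\<And>S. S \<in> E \<Longrightarrow> continuous_map K euclideanreal (u S)"
      "\<And>S. S \<in> E \<Longrightarrow> u S ` topspace K \<subseteq> {0..1}"
      "\<And>S t. S \<in> E \<Longrightarrow> t \<in> {0..1} \<Longrightarrow> u S (g S t) = t"
      "\<And>S x. S \<in> E \<Longrightarrow> x \<in> T S \<Longrightarrow> u S x = 1"
      "\<And>S S' x. S \<in> E \<Longrightarrow> S' \<in> E - {S} \<Longrightarrow> x \<in> A S' \<union> T S' \<Longrightarrow> u S x = 0"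
    using param_u unfolding param_def by blast+
  \<comment> \<open>the retraction of the cube onto its axes, in coordinates\<close>
  define \<rho> where "\<rho> S x = max 0 (u S x - (\<Sum>S'\<in>E - {S}. u S' x))" for S x
  have cont\<rho>: "continuous_map K euclideanreal (\<rho> S)" if "S \<in> E" for S
    unfolding \<rho>_def using u(1) that E
    by (intro continuous_map_real_max continuous_map_diff continuous_map_sum) auto
  have u01: "0 \<le> u S x" "u S x \<le> 1" if "S \<in> E" "x \<in> topspace K" for S x
    using u(2)[OF that(1)] that(2) by auto
  have \<rho>01: "\<rho> S x \<in> {0..1}" if "S \<in> E" "x \<in> topspace K" for S x
  proof -
    have "0 \<le> (\<Sum>S'\<in>E - {S}. u S' x)" using u01 that by (intro sum_nonneg) auto
    then show ?thesis using u01(2)[OF that] by (auto simp: \<rho>_def)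
  qed
  have single: "\<rho> S' x = 0" if S: "S \<in> E" "S' \<in> E" "S \<noteq> S'" "x \<in> topspace K" "\<rho> S x \<noteq> 0" for S S' x
  proof -
    have "u S' x \<le> (\<Sum>S''\<in>E - {S}. u S'' x)" "u S x \<le> (\<Sum>S''\<in>E - {S'}. u S'' x)"
      using S E u01 by (intro member_le_sum; auto)+
    then show ?thesis using S(5) by (auto simp: \<rho>_def max_def split: if_splits)
  qed
  have cover: "\<exists>S\<in>E. \<forall>S'\<in>E - {S}. \<rho> S' x = 0" if x: "x \<in> topspace K" for x
  proof (cases "\<exists>S\<in>E. \<rho> S x \<noteq> 0")
    case True
    then obtain S where S: "S \<in> E" "\<rho> S x \<noteq> 0" by blast
    have "\<forall>S'\<in>E - {S}. \<rho> S' x = 0"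
      using single[OF S(1) _ _ x S(2)] by blast
    then show ?thesis using S(1) by blast
  next
    case False
    with \<open>E \<noteq> {}\<close> show ?thesis by blast
  qed
  \<comment> \<open>the points sent to the axis of \<open>S\<close>; these sets cover \<open>K\<close> and overlap only over the centre\<close>
  let ?D = "\<lambda>S. {x \<in> topspace K. \<forall>S'\<in>E - {S}. \<rho> S' x = 0}"
  obtain r where r: "continuous_map K K r"
    "\<And>x S. \<lbrakk>S \<in> E; x \<in> topspace K \<inter> ?D S\<rbrakk> \<Longrightarrow> r x = g S (\<rho> S x)"
  proof (rule pasting_lemma_exists_closed[of E K ?D K "\<lambda>S x. g S (\<rho> S x)"])
    show "finite E" by (fact E)
    show "topspace K \<subseteq> \<Union> (?D ` E)"
    proof
      fix x assume "x \<in> topspace K"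
      with cover obtain S where "S \<in> E" "\<forall>S'\<in>E - {S}. \<rho> S' x = 0" by blast
      with \<open>x \<in> topspace K\<close> show "x \<in> \<Union> (?D ` E)" by blast
    qed
    fix S assume S: "S \<in> E"
    show "closedin K (?D S)"
    proof (cases "E - {S} = {}")
      case True then show ?thesis by (simp add: True)
    next
      case False
      have "?D S = (\<Inter>S'\<in>E - {S}. {x \<in> topspace K. \<rho> S' x \<in> {0}})"
        using False by blast
      also have "closedin K \<dots>"
        by (intro closedin_INT False closedin_continuous_map_preimage[OF cont\<rho>]) auto
      finally show ?thesis .
    qed
    have "continuous_map K (top_of_set {0..1}) (\<rho> S)"
      using cont\<rho>[OF S] \<rho>01[OF S] by (auto simp: continuous_map_in_subtopology)
    then have "continuous_map K K (g S \<circ> \<rho> S)"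
      using contg[OF S] by (rule continuous_map_compose)
    then show "continuous_map (subtopology K (?D S)) K (\<lambda>x. g S (\<rho> S x))"
      by (simp add: continuous_map_from_subtopology o_def)
  next
    fix S S' x
    assume *: "S \<in> E" "S' \<in> E" "x \<in> topspace K \<inter> ?D S \<inter> ?D S'"
    show "g S (\<rho> S x) = g S' (\<rho> S' x)"
    proof (cases "S = S'")
      case False
      then have "\<rho> S x = 0" "\<rho> S' x = 0" using * by auto
      then show ?thesis using g(3) * by simp
    qed simp
  qed auto
  have r_at: "r x = g S (\<rho> S x)" if "S \<in> E" "x \<in> topspace K" "\<And>S'. S' \<in> E - {S} \<Longrightarrow> \<rho> S' x = 0" for S x
    using r(2)[of S x] that by auto
  have on_A: "r (g S t) = g S t" if S: "S \<in> E" and t: "t \<in> {0..1}" for S t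
  proof -
    have gA: "g S t \<in> A S" using g(2)[OF S] t by (metis imageI)
    then have gK: "g S t \<in> topspace K" using clA[OF S] closedin_subset by blast
    have 0: "u S' (g S t) = 0" if "S' \<in> E - {S}" for S'
      using u(5)[of S' S] that S gA by auto
    then have "(\<Sum>S'\<in>E - {S}. u S' (g S t)) = 0" by (simp add: sum.neutral)
    then have "\<rho> S (g S t) = t"
      using u(3)[OF S t] t by (auto simp: \<rho>_def)
    moreover have "\<rho> S' (g S t) = 0" if "S' \<in> E - {S}" for S'
    proof -
      have "0 \<le> (\<Sum>S''\<in>E - {S'}. u S'' (g S t))" using u01 gK by (intro sum_nonneg) auto
      then show ?thesis using 0[OF that] by (auto simp: \<rho>_def)
    qed
    ultimately show ?thesis using r_at[OF S gK] by simp
  qed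
  have on_T: "r x = y S" if S: "S \<in> E" and x: "x \<in> T S" for S x
  proof -
    have xK: "x \<in> topspace K" using T[OF S] x closedin_subset by blast
    have 0: "u S' x = 0" if "S' \<in> E - {S}" for S'
      using u(5)[of S' S] that S x by auto
    then have "(\<Sum>S'\<in>E - {S}. u S' x) = 0" by (simp add: sum.neutral)
    then have "\<rho> S x = 1"
      using u(4)[OF S x] by (auto simp: \<rho>_def)
    moreover have "\<rho> S' x = 0" if "S' \<in> E - {S}" for S'
    proof -
      have "0 \<le> (\<Sum>S''\<in>E - {S'}. u S'' x)" using u01 xK by (intro sum_nonneg) auto
      then show ?thesis using 0[OF that] by (auto simp: \<rho>_def)
    qed
    ultimately show ?thesis using r_at[OF S xK] g(4)[OF S] by simp
  qed
  show thesis
  proof (rule that[OF r(1)])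
    show "r ` topspace K \<subseteq> insert c (\<Union>(A ` E))"
    proof (clarify)
      fix x assume x: "x \<in> topspace K"
      then obtain S where S: "S \<in> E" "\<And>S'. S' \<in> E - {S} \<Longrightarrow> \<rho> S' x = 0"
        using cover by blast
      then have "r x = g S (\<rho> S x)" using r_at x by blast
      then have "r x \<in> A S" using g(2)[OF S(1)] \<rho>01[OF S(1) x] by (metis imageI)
      moreover assume "r x \<notin> \<Union>(A ` E)"
      ultimately show "r x = c" using S(1) by blast
    qed
    show "r x = x" if x: "x \<in> insert c (\<Union>(A ` E))" for x
    proof -
      obtain S0 where "S0 \<in> E" using False by blast
      then obtain S where S: "S \<in> E" "x \<in> A S" using x cA[of S0] by auto
      then have "x \<in> g S ` {0..1}" using g(2)[OF S(1)] by simp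
      then obtain t where "x = g S t" "t \<in> {0..1}" by (rule imageE)
      then show ?thesis using on_A S(1) by blast
    qed
  qed (use on_T in auto)
qed

lemma arc_from_to_subtopology:
  assumes "arc_from_to X A p q" "A \<subseteq> Q"
  shows "arc_from_to (subtopology X Q) A p q"
  using assms by (auto simp: arc_from_to_def embedding_map_in_subtopology)

text \<open>The case needed for the pieces of \<open>X\<close>: the ambient space is a closed subspace, and the
  collapsed sets are the edges, which serve as their own index.\<close>
lemma star_retraction_closedin:
  fixes X :: "'a topology" and A :: "'a set \<Rightarrow> 'a set" and y :: "'a set \<Rightarrow> 'a"
  assumes X: "compact_space X" "Hausdorff_space X" and Q: "closedin X Q" and E: "finite E" and c: "c \<in> Q"
    and arc: "\<And>S. S \<in> E \<Longrightarrow> arc_from_to X (A S) c (y S)" "\<And>S. S \<in> E \<Longrightarrow> A S \<subseteq> Q"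
    and T: "\<And>S. S \<in> E \<Longrightarrow> closedin X S" "\<And>S. S \<in> E \<Longrightarrow> S \<subseteq> Q"
    and AT: "\<And>S. S \<in> E \<Longrightarrow> A S \<inter> S = {y S}"
    and AA: "\<And>S S'. S \<in> E \<Longrightarrow> S' \<in> E \<Longrightarrow> S \<noteq> S' \<Longrightarrow> A S \<inter> A S' = {c}"
    and AT': "\<And>S S'. S \<in> E \<Longrightarrow> S' \<in> E \<Longrightarrow> S \<noteq> S' \<Longrightarrow> A S \<inter> S' = {}"
    and TT: "\<And>S S'. S \<in> E \<Longrightarrow> S' \<in> E \<Longrightarrow> S \<noteq> S' \<Longrightarrow> S \<inter> S' = {}"
  shows "\<exists>r. continuous_map (subtopology X Q) X r \<and> r ` Q \<subseteq> insert c (\<Union>(A ` E)) \<and>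
    (\<forall>x \<in> insert c (\<Union>(A ` E)). r x = x) \<and> (\<forall>S\<in>E. \<forall>x\<in>S. r x = y S)"
proof -
  let ?K = "subtopology X Q"
  have QX: "Q \<subseteq> topspace X" using Q closedin_subset by blast
  have K: "compact_space ?K" "Hausdorff_space ?K" "c \<in> topspace ?K"
    using X Q c QX by (auto simp: Hausdorff_space_subtopology closedin_compact_space compact_space_subtopology)
  have arcK: "arc_from_to ?K (A S) c (y S)" if "S \<in> E" for S
    using arc_from_to_subtopology[OF arc(1,2)[OF that]] .
  have cloK: "closedin ?K S" if "S \<in> E" for S
    using closedin_subset_topspace[OF T(1,2)[OF that]] .
  have topK: "topspace ?K = Q" using QX by auto
  show ?thesis
  proof (rule star_retraction[where T = "\<lambda>S. S", OF K(1,2) E K(3) arcK cloK AT AA AT' TT])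
    fix r assume r: "continuous_map ?K ?K r" "r ` topspace ?K \<subseteq> insert c (\<Union>(A ` E))"
      "\<And>x. x \<in> insert c (\<Union>(A ` E)) \<Longrightarrow> r x = x" "\<And>S x. S \<in> E \<Longrightarrow> x \<in> S \<Longrightarrow> r x = y S"
    show ?thesis
    proof (intro exI[of _ r] conjI ballI)
      show "continuous_map ?K X r" using r(1) continuous_map_into_fulltopology by blast
      show "r ` Q \<subseteq> insert c (\<Union>(A ` E))" using r(2) unfolding topK .
    qed (fact r(3), fact r(4))
  qed
qed

section \<open>Invariance of domain in a surface\<close>

text \<open>The chart \<open>k\<close> maps an open neighbourhood onto an open subset of the plane that need not be the
  whole plane; this form passes to smaller neighbourhoods.\<close>
definition planar_at :: "'a topology \<Rightarrow> 'a \<Rightarrow> bool" where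
  "planar_at X x \<longleftrightarrow> (\<exists>V k. openin X V \<and> x \<in> V \<and>
     continuous_map (subtopology X V) (euclidean :: (real \<times> real) topology) k \<and>
     open_map (subtopology X V) euclidean k \<and> inj_on k V)"

lemma planar_at_if_neighbourhood:
  assumes "neighbourhood_of X x U"
    and "subtopology X U homeomorphic_space (euclidean :: (real \<times> real) topology)"
  shows "planar_at X x"
proof -
  obtain k where k: "homeomorphic_map (subtopology X U) (euclidean :: (real \<times> real) topology) k"
    using assms(2) homeomorphic_space by blast
  have U: "U \<subseteq> topspace X" "x \<in> X interior_of U"
    using assms(1) by (auto simp: neighbourhood_of_def)
  have sub: "X interior_of U \<subseteq> U" by (rule interior_of_subset)
  have opn: "openin (subtopology X U) (X interior_of U)"
    unfolding openin_subtopology using sub by (metis inf.absorb1 openin_interior_of)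
  have eq: "subtopology X (X interior_of U) = subtopology (subtopology X U) (X interior_of U)"
    by (simp add: subtopology_subtopology inf.absorb2 sub)
  show ?thesis
    unfolding planar_at_def
  proof (intro exI conjI)
    show "continuous_map (subtopology X (X interior_of U)) euclidean k"
      unfolding eq using k by (simp add: continuous_map_from_subtopology homeomorphic_imp_continuous_map)
    show "open_map (subtopology X (X interior_of U)) euclidean k"
      unfolding eq using homeomorphic_imp_open_map[OF k] opn
      by (auto simp: open_map_def openin_open_subtopology)
    show "inj_on k (X interior_of U)"
      using homeomorphic_imp_injective_map[OF k] U(1) sub
      by (metis inf.absorb2 inj_on_subset topspace_subtopology)
  qed (use U in auto)
qed

text \<open>Invariance of domain, transported to the planar part of \<open>X\<close>: near \<open>G z\<close> the composite of \<open>G\<close>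
  with a planar chart is a continuous injection between subsets of the plane. The points that are
  not planar are removed from the image, so \<open>G\<close> may run into the singular curves.\<close>
lemma planar_image_openin:
  fixes G :: "real \<times> real \<Rightarrow> 'a"
  assumes G: "continuous_map (top_of_set O1) X G" "inj_on G O1" and O1: "open O1"
  shows "openin X {x \<in> G ` O1. planar_at X x}"
proof (subst openin_subopen, clarify)
  fix z assume z: "z \<in> O1" and "planar_at X (G z)"
  then obtain V and k :: "'a \<Rightarrow> real \<times> real" where V: "openin X V" "G z \<in> V"
    and k: "continuous_map (subtopology X V) euclidean k" "open_map (subtopology X V) euclidean k"
      "inj_on k V"
    by (auto simp: planar_at_def)
  have VX: "V \<subseteq> topspace X" using V(1) openin_subset by blast
  define O2 where "O2 = {z \<in> O1. G z \<in> V}"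
  have "openin (top_of_set O1) O2"
    using openin_continuous_map_preimage[OF G(1) V(1)] by (simp add: O2_def)
  then have O2: "open O2" using O1 openin_open_trans by blast
  have "continuous_map (top_of_set O2) (subtopology X V) G"
    using G(1) by (auto simp: continuous_map_in_subtopology O2_def intro: continuous_map_from_subtopology_mono)
  then have "continuous_map (top_of_set O2) euclidean (k \<circ> G)"
    using k(1) by (rule continuous_map_compose)
  then have "continuous_on O2 (k \<circ> G)" by simp
  moreover have "inj_on (k \<circ> G) O2"
    using G(2) k(3) by (auto simp: O2_def inj_on_def)
  ultimately have op: "open ((k \<circ> G) ` O2)" using O2 invariance_of_domain by blast
  have "openin (subtopology X V) {v \<in> V. k v \<in> (k \<circ> G) ` O2}"
    using openin_continuous_map_preimage[OF k(1), of "(k \<circ> G) ` O2"] op VX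
    by (simp add: inf.absorb2)
  then have "openin X {v \<in> V. k v \<in> (k \<circ> G) ` O2}"
    using V(1) openin_trans_full by blast
  moreover have "{v \<in> V. k v \<in> (k \<circ> G) ` O2} = G ` O2"
    using k(3) by (auto simp: O2_def inj_on_def)
  ultimately have "openin X (G ` O2)" by simp
  moreover have "G ` O2 \<subseteq> {x \<in> G ` O1. planar_at X x}"
    using V(1) k by (auto simp: O2_def planar_at_def)
  moreover have "G z \<in> G ` O2" using z V(2) by (auto simp: O2_def)
  ultimately show "\<exists>T. openin X T \<and> G z \<in> T \<and> T \<subseteq> {x \<in> G ` O1. planar_at X x}"
    by blast
qed

text \<open>The preimage of a small disc under a planar chart is a copy of the whole plane.\<close>
lemma planar_at_plane_neighbourhood:
  assumes "planar_at X x" "openin X Q" "x \<in> Q"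
  obtains Z where "openin X Z" "x \<in> Z" "Z \<subseteq> Q"
    "subtopology X Z homeomorphic_space (euclidean :: (real \<times> real) topology)"
proof -
  obtain V and k :: "'a \<Rightarrow> real \<times> real" where V: "openin X V" "x \<in> V"
    and k: "continuous_map (subtopology X V) euclidean k" "open_map (subtopology X V) euclidean k"
      "inj_on k V"
    using assms(1) by (auto simp: planar_at_def)
  have VX: "V \<subseteq> topspace X" using V(1) openin_subset by blast
  have "openin (subtopology X V) (Q \<inter> V)"
    using assms(2) by (metis openin_subtopology)
  then have "open (k ` (Q \<inter> V))" using k(2) by (simp add: open_map_def)
  moreover have "k x \<in> k ` (Q \<inter> V)" using assms(3) V(2) by blast
  ultimately obtain e where e: "e > 0" "ball (k x) e \<subseteq> k ` (Q \<inter> V)"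
    using open_contains_ball by blast
  define Z where "Z = {v \<in> V. k v \<in> ball (k x) e}"
  have ZV: "Z \<subseteq> V" by (auto simp: Z_def)
  have "openin (subtopology X V) {v \<in> topspace (subtopology X V). k v \<in> ball (k x) e}"
    by (rule openin_continuous_map_preimage[OF k(1)]) simp
  moreover have "topspace (subtopology X V) = V" using VX by auto
  ultimately have ZoV: "openin (subtopology X V) Z" by (simp only: Z_def)
  then have Zo: "openin X Z" using V(1) openin_trans_full by blast
  have kZ: "k ` Z = ball (k x) e"
  proof
    show "ball (k x) e \<subseteq> k ` Z"
    proof
      fix z assume z: "z \<in> ball (k x) e"
      then obtain v where "v \<in> V" "z = k v" using e(2) by blast
      then show "z \<in> k ` Z" using z by (auto simp: Z_def)
    qed
  qed (auto simp: Z_def)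
  have ZQ: "Z \<subseteq> Q"
  proof
    fix v assume v: "v \<in> Z"
    then have "k v \<in> ball (k x) e" "v \<in> V" by (auto simp: Z_def)
    then obtain v' where "v' \<in> Q \<inter> V" "k v = k v'" using e(2) by blast
    then show "v \<in> Q" using k(3) \<open>v \<in> V\<close> by (auto dest: inj_onD)
  qed
  have sub: "subtopology X Z = subtopology (subtopology X V) Z"
    using ZV by (simp add: subtopology_subtopology inf.absorb2)
  have "continuous_map (subtopology X Z) euclidean k"
    unfolding sub using k(1) by (rule continuous_map_from_subtopology)
  moreover have "open_map (subtopology X Z) euclidean k"
    unfolding sub open_map_def using k(2) ZoV by (simp add: openin_open_subtopology open_map_def)
  moreover have "inj_on k (topspace (subtopology X Z))"
    using k(3) ZV by (auto intro: inj_on_subset)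
  ultimately have "embedding_map (subtopology X Z) euclidean k"
    by (rule injective_open_imp_embedding_map)
  moreover have "topspace (subtopology X Z) = Z" using ZV VX by auto
  ultimately have "subtopology X Z homeomorphic_space top_of_set (ball (k x) e)"
    using embedding_map_imp_homeomorphic_space[of "subtopology X Z" euclidean k] kZ by simp
  also have "\<dots> homeomorphic_space (euclidean :: (real \<times> real) topology)"
  proof -
    obtain f g where "homeomorphism (ball (k x) e) (UNIV :: (real \<times> real) set) f g"
      using homeomorphic_ball_UNIV[OF e(1), of "k x"] by (auto simp: homeomorphic_def)
    then have "homeomorphic_maps (top_of_set (ball (k x) e)) (euclidean :: (real \<times> real) topology) f g"
      unfolding homeomorphism_def homeomorphic_maps_def continuous_map_in_subtopology by auto
    then show ?thesis by (auto simp: homeomorphic_space_def)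
  qed
  finally have "subtopology X Z homeomorphic_space (euclidean :: (real \<times> real) topology)" .
  moreover have "x \<in> Z" using V(2) e(1) by (simp add: Z_def)
  ultimately show thesis using that[of Z] Zo ZQ by blast
qed

corollary openin_if_homeomorphic_plane:
  assumes D: "subtopology X D homeomorphic_space (euclidean :: (real \<times> real) topology)"
    and "D \<subseteq> topspace X" "\<And>x. x \<in> D \<Longrightarrow> planar_at X x"
  shows "openin X D"
proof -
  obtain G where "homeomorphic_map (euclidean :: (real \<times> real) topology) (subtopology X D) G"
    using D homeomorphic_space homeomorphic_space_sym by blast
  then have G: "continuous_map (top_of_set UNIV) X G" "inj_on G UNIV" "G ` UNIV = D"
    using assms(2) by (auto simp: homeomorphic_eq_everything_map continuous_map_in_subtopology)
  from planar_image_openin[OF G(1,2)] have "openin X {x \<in> D. planar_at X x}"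
    using G(3) by simp
  moreover have "{x \<in> D. planar_at X x} = D" using assms(3) by auto
  ultimately show ?thesis by simp
qed

lemma half_plane_topology:
  "prod_topology euclideanreal (top_of_set {0..<1::real}) = top_of_set (UNIV \<times> {0..<1})"
  using subtopology_Times[of euclideanreal euclideanreal UNIV "{0..<1}"]
  by (simp add: euclidean_product_topology)

text \<open>Boundary points are used through the inverse \<open>G\<close> of a chart, since invariance of domain is
  applied to maps out of the half plane.\<close>
lemma nbhd_boundary_chart:
  assumes "x \<in> nbhd_boundary X N" "N \<subseteq> topspace X"
  obtains f G a where "openin (subtopology X N) (G ` (UNIV \<times> {0..<1::real}))"
    "continuous_map (top_of_set (UNIV \<times> {0..<1::real})) X G"
    "continuous_map (subtopology X (G ` (UNIV \<times> {0..<1::real}))) (euclidean :: (real \<times> real) topology) f"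
    "\<And>z. z \<in> UNIV \<times> {0..<1} \<Longrightarrow> f (G z) = z" "x = G (a, 0)"
proof -
  obtain U and f :: "'a \<Rightarrow> real \<times> real" where U: "openin (subtopology X N) U" "x \<in> U"
    and f: "homeomorphic_map (subtopology X U) (top_of_set (UNIV \<times> {0..<1})) f" "snd (f x) = 0"
    using assms by (auto simp: nbhd_boundary_def half_plane_topology)
  have UX: "U \<subseteq> topspace X" using U(1) openin_subset by fastforce
  obtain G where G: "homeomorphic_maps (subtopology X U) (top_of_set (UNIV \<times> {0..<1})) f G"
    using f(1) homeomorphic_map_maps by blast
  have im: "G ` (UNIV \<times> {0..<1}) = U"
    using homeomorphic_imp_surjective_map[of "top_of_set (UNIV \<times> {0..<1})" "subtopology X U" G]
      G UX homeomorphic_maps_map homeomorphic_maps_sym by (metis inf.absorb2 topspace_euclidean_subtopology topspace_subtopology)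
  show thesis
  proof
    show "openin (subtopology X N) (G ` (UNIV \<times> {0..<1}))" using U im by simp
    show "continuous_map (top_of_set (UNIV \<times> {0..<1})) X G"
      using G by (auto simp: homeomorphic_maps_def continuous_map_in_subtopology)
    show "continuous_map (subtopology X (G ` (UNIV \<times> {0..<1}))) euclidean f"
      unfolding im using G by (auto simp: homeomorphic_maps_def continuous_map_in_subtopology)
    show "f (G z) = z" if "z \<in> UNIV \<times> {0..<1}" for z
      using G that by (auto simp: homeomorphic_maps_def)
    have "G (f x) = x" using G U(2) UX by (auto simp: homeomorphic_maps_def)
    then show "x = G (fst (f x), 0)" using f(2) by (metis prod.collapse)
  qed
qed

text \<open>If \<open>x\<close> were interior to \<open>N\<close>, a planar neighbourhood of \<open>x\<close> would embed into the half plane with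
  \<open>x\<close> on the boundary line. By invariance of domain the image is open in the plane, so it contains
  points below the line.\<close>
lemma nbhd_boundary_not_interior:
  assumes x: "x \<in> nbhd_boundary X N" and NX: "N \<subseteq> topspace X" and "planar_at X x"
  shows "x \<notin> X interior_of N"
proof
  assume int: "x \<in> X interior_of N"
  let ?H = "UNIV \<times> {0..<1::real} :: (real \<times> real) set"
  obtain f G a where G: "openin (subtopology X N) (G ` ?H)"
    "continuous_map (top_of_set ?H) X G" "continuous_map (subtopology X (G ` ?H)) euclidean f"
    "\<And>z. z \<in> ?H \<Longrightarrow> f (G z) = z" "x = G (a, 0)"
    using nbhd_boundary_chart[OF x NX] by metis
  obtain V and k :: "'a \<Rightarrow> real \<times> real" where V: "openin X V" "x \<in> V"
    and k: "continuous_map (subtopology X V) euclidean k" "open_map (subtopology X V) euclidean k"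
      "inj_on k V"
    using assms(3) by (auto simp: planar_at_def)
  have xG: "x \<in> G ` ?H" using G(5) by auto
  obtain Q where Q: "openin X Q" "G ` ?H = Q \<inter> N" using G(1) by (auto simp: openin_subtopology)
  define D where "D = Q \<inter> X interior_of N \<inter> V"
  have D: "openin X D" "x \<in> D" "D \<subseteq> V" "D \<subseteq> G ` ?H"
    using Q V int xG interior_of_subset[of X N] by (auto simp: D_def intro!: openin_Int)
  have DX: "D \<subseteq> topspace X" "V \<subseteq> topspace X" using D(1) V(1) openin_subset by auto
  have DV: "openin (subtopology X V) D"
    using D by (metis inf.absorb1 openin_subtopology)
  have kD: "open (k ` D)" using k(2) DV by (simp add: open_map_def)
  have "embedding_map (subtopology X V) euclidean k"
    using k DX by (intro injective_open_imp_embedding_map) (auto simp: inf.absorb2)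
  then have "homeomorphic_map (subtopology X V) (top_of_set (k ` V)) k"
    using DX by (simp add: embedding_map_def inf.absorb2)
  then obtain l where l: "homeomorphic_maps (subtopology X V) (top_of_set (k ` V)) k l"
    using homeomorphic_map_maps by blast
  have lk: "l (k v) = v" if "v \<in> V" for v using l that DX by (auto simp: homeomorphic_maps_def)
  have lV: "continuous_map (top_of_set (k ` V)) X l"
    using l by (auto simp: homeomorphic_maps_def continuous_map_in_subtopology)
  have "continuous_map (top_of_set (k ` D)) (subtopology X (G ` ?H)) l"
    unfolding continuous_map_in_subtopology
  proof (intro conjI)
    show "continuous_map (top_of_set (k ` D)) X l"
      using lV image_mono[OF D(3)]
      by (rule continuous_map_from_subtopology_mono)
    show "l \<in> topspace (top_of_set (k ` D)) \<rightarrow> G ` ?H"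
    proof
      fix z assume "z \<in> topspace (top_of_set (k ` D))"
      then obtain v where "v \<in> D" "z = k v" by auto
      then show "l z \<in> G ` ?H" using D(3,4) lk by (metis subsetD)
    qed
  qed
  from continuous_map_compose[OF this G(3)] have cont: "continuous_on (k ` D) (f \<circ> l)"
    by simp
  have fl: "(f \<circ> l) (k v) = f v" if "v \<in> D" for v
    using lk[of v] that D(3) by auto
  have injf: "inj_on f D"
  proof (rule inj_on_inverseI)
    fix v assume "v \<in> D"
    then obtain z where "z \<in> ?H" "v = G z" using D(4) by blast
    then show "G (f v) = v" using G(4) by simp
  qed
  have "inj_on (f \<circ> l) (k ` D)"
  proof (rule inj_onI)
    fix z z' assume "z \<in> k ` D" "z' \<in> k ` D" and eq: "(f \<circ> l) z = (f \<circ> l) z'"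
    then obtain v v' where v: "v \<in> D" "v' \<in> D" "z = k v" "z' = k v'" by blast
    then have "f v = f v'" using eq fl by simp
    then show "z = z'" using v injf by (simp add: inj_on_eq_iff)
  qed
  then have "open ((f \<circ> l) ` k ` D)"
    using invariance_of_domain[OF cont kD] by blast
  moreover have "(f \<circ> l) ` k ` D = f ` D"
    unfolding image_image using fl by (rule image_cong[OF refl])
  ultimately have fD: "open (f ` D)" by simp
  have "(a, 0) \<in> f ` D" using G(4)[of "(a,0)"] G(5) D(2) by force
  then obtain e where e: "e > 0" "ball (a, 0) e \<subseteq> f ` D"
    using fD open_contains_ball by blast
  have "(a, - e / 2) \<in> ball (a, 0) e" using e(1) by (simp add: dist_Pair_Pair)
  then have "(a, - e / 2) \<in> f ` G ` ?H" using e(2) D(4) by blast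
  then have "(a, - e / 2) \<in> ?H" using G(4) by force
  then show False using e(1) by simp
qed

text \<open>The open half of a half-plane chart at \<open>x\<close> has image open in \<open>X\<close> near \<open>x\<close>, so it consists of
  interior points of \<open>N\<close> that accumulate at \<open>x\<close>. This is what prevents a frontier point of \<open>N\<close> from
  being an interior point of the complementary surface.\<close>
lemma nbhd_boundary_adherent_to_interior:
  assumes x: "x \<in> nbhd_boundary X N" and NX: "N \<subseteq> topspace X"
    and V: "openin X V" "x \<in> V" and pl: "planar_at X x"
  shows "V \<inter> X interior_of N \<noteq> {}"
proof -
  let ?H = "UNIV \<times> {0..<1::real} :: (real \<times> real) set"
  obtain f G a where G: "openin (subtopology X N) (G ` ?H)"
    "continuous_map (top_of_set ?H) X G"
    "\<And>z. z \<in> ?H \<Longrightarrow> f (G z) = z" "x = G (a, 0)"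
    using nbhd_boundary_chart[OF x NX] by metis
  have GN: "G ` ?H \<subseteq> N" using G(1) openin_subset by fastforce
  obtain V' where V': "openin X V'" "x \<in> V'" "\<And>y. y \<in> V' \<Longrightarrow> planar_at X y"
    using pl unfolding planar_at_def by blast
  have "openin (top_of_set ?H) {z \<in> ?H. G z \<in> V \<inter> V'}"
    using openin_continuous_map_preimage[OF G(2), of "V \<inter> V'"] V V' by (simp add: openin_Int)
  then obtain T where T: "open T" "{z \<in> ?H. G z \<in> V \<inter> V'} = ?H \<inter> T"
    by (auto simp: openin_open)
  have "(a, 0) \<in> {z \<in> ?H. G z \<in> V \<inter> V'}" using V(2) V'(2) G(4) by simp
  then have "(a, 0) \<in> T" unfolding T(2) by simp
  then obtain e where e: "e > 0" "ball (a, 0) e \<subseteq> T" using T(1) open_contains_ball by blast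
  define t where "t = min (e / 2) (1 / 2)"
  have t: "0 < t" "t < 1" "t < e" using e by (auto simp: t_def)
  then have "(a, t) \<in> ball (a, 0) e" by (simp add: dist_Pair_Pair)
  then have at: "(a, t) \<in> T" using e by blast
  define O1 where "O1 = (UNIV \<times> {0<..<1}) \<inter> T"
  have O1: "open O1" unfolding O1_def using T by (intro open_Int open_Times) auto
  have sub: "O1 \<subseteq> ?H" by (auto simp: O1_def)
  have "openin X {y \<in> G ` O1. planar_at X y}"
    using sub inj_on_inverseI[of O1 f G] G(3)
    by (intro planar_image_openin O1 continuous_map_from_subtopology_mono[OF G(2)]) blast+
  moreover have "{y \<in> G ` O1. planar_at X y} \<subseteq> N" using GN sub by auto
  ultimately have "{y \<in> G ` O1. planar_at X y} \<subseteq> X interior_of N"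
    by (simp add: interior_of_maximal)
  moreover have "(a, t) \<in> {z \<in> ?H. G z \<in> V \<inter> V'}" unfolding T(2) using at t by simp
  then have "G (a, t) \<in> V \<inter> V'" by simp
  moreover have "(a, t) \<in> O1" using at t by (simp add: O1_def)
  ultimately show ?thesis using V'(3) by blast
qed

section \<open>Charts of the mapping torus\<close>

lemma quotient_map_quotient_topology:
  "quotient_map X (quotient_topology X R) (\<lambda>x. R `` {x})"
  unfolding quotient_map_def topspace_quotient_topology openin_quotient_topology
  by (auto simp: quotient_def)

lemma torus_class_eq_iff:
  assumes h: "homeomorphic_map Y Y h" and "y \<in> topspace Y" "z \<in> topspace Y" "s \<in> {0..1}" "t \<in> {0..1}"
  shows "torus_rel Y h `` {(y, s)} = torus_rel Y h `` {(z, t)} \<longleftrightarrow>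
    y = z \<and> s = t \<or> s = 1 \<and> t = 0 \<and> z = h y \<or> s = 0 \<and> t = 1 \<and> y = h z"
proof -
  have "torus_rel Y h `` {(y, s)} = torus_rel Y h `` {(z, t)} \<longleftrightarrow> ((y, s), (z, t)) \<in> torus_rel Y h"
    using assms by (intro eq_equiv_class_iff[OF equiv_torus_rel[OF h]]) auto
  also have "\<dots> \<longleftrightarrow> y = z \<and> s = t \<or> s = 1 \<and> t = 0 \<and> z = h y \<or> s = 0 \<and> t = 1 \<and> y = h z"
    using assms by (auto simp: torus_rel_def Let_def)
  finally show ?thesis .
qed

lemma real_homeomorphic_open_interval:
  obtains \<sigma> \<tau> :: "real \<Rightarrow> real" where "continuous_on UNIV \<sigma>" "continuous_on {-1/2<..<1/2} \<tau>"
    "\<And>r. \<sigma> r \<in> {-1/2<..<1/2}" "\<And>r. \<tau> (\<sigma> r) = r" "\<And>t. t \<in> {-1/2<..<1/2} \<Longrightarrow> \<sigma> (\<tau> t) = t"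
proof -
  have bd: "- (pi / 2) < pi * t \<and> pi * t < pi / 2" if "t \<in> {-1/2<..<1/2}" for t :: real
  proof -
    have "pi * (-1/2) < pi * t" "pi * t < pi * (1/2)"
      using that by (intro mult_strict_left_mono; simp)+
    then show ?thesis by simp
  qed
  have "cos (pi * t) \<noteq> 0" if "t \<in> {-1/2<..<1/2}" for t :: real
    using cos_gt_zero_pi[of "pi * t"] bd[OF that] by simp
  then have 1: "continuous_on {-1/2<..<1/2::real} (\<lambda>t. tan (pi * t))"
    by (intro continuous_intros) auto
  have 2: "continuous_on UNIV (\<lambda>r::real. arctan r / pi)"
    by (intro continuous_intros) auto
  have 3: "arctan r / pi \<in> {-1/2<..<1/2}" for r
    using arctan_bounded[of r] by (simp add: field_simps)
  show thesis
    by (rule that[OF 2 1 3]) (use bd in \<open>auto simp: tan_arctan arctan_tan\<close>)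
qed

lemma continuous_map_real_snd:
  assumes "continuous_on UNIV f"
  shows "continuous_map (prod_topology Y euclideanreal) euclideanreal (\<lambda>p. f (snd p))"
proof -
  have "continuous_map euclideanreal euclideanreal f" using assms by simp
  from continuous_map_compose[OF continuous_map_snd this] show ?thesis by (simp add: o_def)
qed

lemma continuous_map_snd_interval:
  fixes f :: "real \<Rightarrow> real"
  assumes "continuous_on J f" and "\<And>p. p \<in> Q \<Longrightarrow> snd p \<in> I \<Longrightarrow> snd p \<in> J"
  shows "continuous_map (subtopology (prod_topology Y (top_of_set I)) Q) euclideanreal (\<lambda>p. f (snd p))"
proof -
  have "continuous_map (prod_topology Y (top_of_set I)) euclideanreal snd"
    using continuous_map_snd continuous_map_into_fulltopology by blast
  then have "continuous_map (subtopology (prod_topology Y (top_of_set I)) Q) euclideanreal snd"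
    by (rule continuous_map_from_subtopology)
  then have "continuous_map (subtopology (prod_topology Y (top_of_set I)) Q) (top_of_set J) snd"
    using assms(2) by (auto simp: continuous_map_in_subtopology)
  from continuous_map_compose[OF this, of euclideanreal f] show ?thesis
    using assms(1) by (simp add: o_def)
qed

text \<open>
  For \<open>t \<noteq> 0\<close> the chart is the quotient map on \<open>Y \<times> (0, 1)\<close>, where nothing is identified. At the
  gluing level \<open>t = 0\<close> the piece \<open>Y \<times> [0, 1/2)\<close> is continued through negative times by \<open>Y \<times> (1/2, 1]\<close>,
  twisted by the inverse \<open>h'\<close> of the gluing map: a time \<open>s < 0\<close> stands for the class of \<open>(h' y, 1 + s)\<close>.
  The homeomorphism \<open>\<sigma>\<close> of \<open>\<real>\<close> onto \<open>(-1/2, 1/2)\<close> gives both charts the whole line as time axis,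
  as the half-plane charts \<open>\<real> \<times> [0, 1)\<close> require.
\<close>
lemma mapping_torus_chart:
  assumes hm: "homeomorphic_map Y Y h" and y: "y \<in> topspace Y" and t: "0 \<le> t" "t < 1"
  obtains e r where "continuous_map (prod_topology Y euclideanreal) (mapping_torus Y h) e"
    "open_map (prod_topology Y euclideanreal) (mapping_torus Y h) e"
    "inj_on e (topspace Y \<times> UNIV)" "e (y, r) = torus_rel Y h `` {(y, t)}"
proof -
  let ?cl = "\<lambda>p. torus_rel Y h `` {p}"
  let ?D = "prod_topology Y euclideanreal"
  let ?P = "prod_topology Y (top_of_set {0..1::real})"
  obtain h' where hh': "homeomorphic_maps Y Y h h'"
    using hm homeomorphic_map_maps by blast
  have ch: "continuous_map Y Y h" "continuous_map Y Y h'"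
    and h'h: "\<And>y. y \<in> topspace Y \<Longrightarrow> h' (h y) = y" and hh: "\<And>y. y \<in> topspace Y \<Longrightarrow> h (h' y) = y"
    using hh' by (auto simp: homeomorphic_maps_def)
  have hY: "h y \<in> topspace Y" "h' y \<in> topspace Y" if "y \<in> topspace Y" for y
    using ch that by (auto simp: continuous_map_def)
  have q: "quotient_map ?P (mapping_torus Y h) ?cl"
    unfolding mapping_torus_def by (rule quotient_map_quotient_topology)
  have cq: "continuous_map ?P (mapping_torus Y h) ?cl"
    by (rule quotient_imp_continuous_map[OF q])
  have op: "openin (mapping_torus Y h) U"
    if "U \<subseteq> ?cl ` (topspace Y \<times> {0..1})" "openin ?P {p \<in> topspace Y \<times> {0..1}. ?cl p \<in> U}" for U
    using q that unfolding quotient_map_def by simp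
  obtain \<sigma> \<tau> :: "real \<Rightarrow> real" where \<sigma>: "continuous_on UNIV \<sigma>" "continuous_on {-1/2<..<1/2} \<tau>"
    "\<And>r. \<sigma> r \<in> {-1/2<..<1/2}" "\<And>r. \<tau> (\<sigma> r) = r" "\<And>t. t \<in> {-1/2<..<1/2} \<Longrightarrow> \<sigma> (\<tau> t) = t"
    using real_homeomorphic_open_interval by metis
  have \<sigma>b: "- 1/2 < \<sigma> r" "\<sigma> r < 1/2" for r using \<sigma>(3)[of r] by auto
  have fstP: "continuous_map (subtopology ?P Q) Y fst" for Q
    by (intro continuous_map_from_subtopology continuous_map_fst)
  have pre: "openin ?P {p \<in> topspace Y \<times> I. \<rho> p \<in> V}"
    if "openin (top_of_set {0..1}) I" "continuous_map (subtopology ?P (topspace Y \<times> I)) ?D \<rho>" "openin ?D V"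
    for I \<rho> V
  proof -
    have I: "I \<subseteq> {0..1}" using openin_imp_subset[OF that(1)] .
    have o: "openin ?P (topspace Y \<times> I)" using that(1) by (simp add: openin_prod_Times_iff)
    have "topspace (subtopology ?P (topspace Y \<times> I)) = topspace Y \<times> I" using I by auto
    then have "openin (subtopology ?P (topspace Y \<times> I)) {p \<in> topspace Y \<times> I. \<rho> p \<in> V}"
      using openin_continuous_map_preimage[OF that(2,3)] by (simp only:)
    then show ?thesis using o by (rule openin_trans_full)
  qed
  have toP: "continuous_map Z ?P (\<lambda>p. (f p, g p))"
    if "continuous_map Z Y f" "continuous_map Z euclideanreal g"
      "\<And>p. p \<in> topspace Z \<Longrightarrow> 0 \<le> g p \<and> g p \<le> 1" for Z :: "('a \<times> real) topology" and f g
  proof (rule continuous_map_pairedI[OF that(1)])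
    show "continuous_map Z (top_of_set {0..1}) g"
      unfolding continuous_map_in_subtopology using that(2,3) by auto
  qed
  have cont\<sigma>: "continuous_map ?D euclideanreal (\<lambda>p. \<sigma> (snd p))"
    by (rule continuous_map_real_snd[OF \<sigma>(1)])
  show thesis
  proof (cases "t = 0")
    case False
    define e where "e = (\<lambda>p :: 'a \<times> real. ?cl (fst p, \<sigma> (snd p) + 1/2))"
    have e: "e (z, r) = ?cl (z, \<sigma> r + 1/2)" for z r by (simp add: e_def)
    have cont: "continuous_map ?D (mapping_torus Y h) e"
    proof -
      have "continuous_map ?D ?P (\<lambda>p. (fst p, \<sigma> (snd p) + 1/2))"
      proof (rule toP[OF continuous_map_fst])
        show "continuous_map ?D euclideanreal (\<lambda>p. \<sigma> (snd p) + 1/2)"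
          by (intro continuous_map_add cont\<sigma>) auto
        show "0 \<le> \<sigma> (snd p) + 1/2 \<and> \<sigma> (snd p) + 1/2 \<le> 1" for p :: "'a \<times> real"
          using \<sigma>b[of "snd p"] by linarith
      qed
      from continuous_map_compose[OF this cq] show ?thesis by (simp add: e_def o_def)
    qed
    have opn: "open_map ?D (mapping_torus Y h) e"
      unfolding open_map_def
    proof (intro allI impI)
      fix V assume V: "openin ?D V"
      have VD: "z \<in> topspace Y" if "(z, r) \<in> V" for z r using openin_subset[OF V] that by auto
      have eq: "{p \<in> topspace Y \<times> {0..1}. ?cl p \<in> e ` V} =
          {p \<in> topspace Y \<times> {0<..<1}. (fst p, \<tau> (snd p - 1/2)) \<in> V}" (is "?L = ?R")
      proof
        show "?L \<subseteq> ?R"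
        proof
          fix p assume "p \<in> ?L"
          then obtain z s z' r where p: "p = (z, s)" "z \<in> topspace Y" "s \<in> {0..1}"
            "?cl (z, s) = e (z', r)" "(z', r) \<in> V" by auto
          then have "z = z' \<and> s = \<sigma> r + 1/2"
            using torus_class_eq_iff[OF hm p(2) VD[OF p(5)] p(3), of "\<sigma> r + 1/2"] \<sigma>b[of r] by (auto simp: e)
          then show "p \<in> ?R" using p \<sigma>(4)[of r] \<sigma>b[of r] by auto
        qed
        show "?R \<subseteq> ?L"
        proof
          fix p assume p: "p \<in> ?R"
          then have "e (fst p, \<tau> (snd p - 1/2)) = ?cl p"
            using \<sigma>(5)[of "snd p - 1/2"] by (auto simp: e)
          moreover have "(fst p, \<tau> (snd p - 1/2)) \<in> V" "p \<in> topspace Y \<times> {0..1}"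
            using p by auto
          ultimately have "?cl p \<in> e ` V" by (metis imageI)
          with \<open>p \<in> topspace Y \<times> {0..1}\<close> show "p \<in> ?L" by blast
        qed
      qed
      have "openin ?P ?R"
      proof (rule pre[OF _ _ V])
        show "openin (top_of_set {0..1}) {0<..<1::real}" by (auto simp: openin_open intro!: exI[of _ "{0<..<1}"])
        have "continuous_on {0<..<1} (\<lambda>s. \<tau> (s - 1/2))"
          by (rule continuous_on_compose2[OF \<sigma>(2)]) (auto intro!: continuous_intros)
        then show "continuous_map (subtopology ?P (topspace Y \<times> {0<..<1})) ?D (\<lambda>p. (fst p, \<tau> (snd p - 1/2)))"
          by (intro continuous_map_pairedI fstP continuous_map_snd_interval) auto
      qed
      moreover have "e ` V \<subseteq> ?cl ` (topspace Y \<times> {0..1})"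
      proof clarify
        fix z r assume "(z, r) \<in> V"
        then have "z \<in> topspace Y" using VD by blast
        then show "e (z, r) \<in> ?cl ` (topspace Y \<times> {0..1})"
          unfolding e using \<sigma>b[of r] by (intro imageI) simp
      qed
      ultimately show "openin (mapping_torus Y h) (e ` V)" using op eq by simp
    qed
    have "inj_on e (topspace Y \<times> UNIV)"
    proof (rule inj_onI; clarify)
      fix z r z' r' assume *: "z \<in> topspace Y" "z' \<in> topspace Y" "e (z, r) = e (z', r')"
      then have "z = z' \<and> \<sigma> r = \<sigma> r'"
        using torus_class_eq_iff[OF hm *(1,2), of "\<sigma> r + 1/2" "\<sigma> r' + 1/2"] \<sigma>b[of r] \<sigma>b[of r'] by (auto simp: e)
      then show "z = z' \<and> r = r'" using \<sigma>(4) by metis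
    qed
    moreover have "e (y, \<tau> (t - 1/2)) = ?cl (y, t)"
      using \<sigma>(5)[of "t - 1/2"] t False by (simp add: e)
    ultimately show thesis using that cont opn by blast
  next
    case True
    define e where "e = (\<lambda>p :: 'a \<times> real. if 0 \<le> \<sigma> (snd p) then ?cl (fst p, \<sigma> (snd p))
      else ?cl (h' (fst p), 1 + \<sigma> (snd p)))"
    have e: "e (z, r) = (if 0 \<le> \<sigma> r then ?cl (z, \<sigma> r) else ?cl (h' z, 1 + \<sigma> r))" for z r
      by (simp add: e_def)
    have cont: "continuous_map ?D (mapping_torus Y h) e"
      unfolding e_def
    proof (rule continuous_map_cases_le)
      show "continuous_map ?D euclideanreal (\<lambda>p. \<sigma> (snd p))" by (rule cont\<sigma>)
      have "continuous_map (subtopology ?D {p \<in> topspace ?D. 0 \<le> \<sigma> (snd p)}) ?P (\<lambda>p. (fst p, \<sigma> (snd p)))"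
      proof (rule toP)
        show "0 \<le> \<sigma> (snd p) \<and> \<sigma> (snd p) \<le> 1" if "p \<in> topspace (subtopology ?D {p \<in> topspace ?D. 0 \<le> \<sigma> (snd p)})" for p
          using \<sigma>b[of "snd p"] that by simp
      qed (intro continuous_map_from_subtopology continuous_map_fst cont\<sigma>)+
      from continuous_map_compose[OF this cq]
      show "continuous_map (subtopology ?D {p \<in> topspace ?D. 0 \<le> \<sigma> (snd p)}) (mapping_torus Y h)
         (\<lambda>p. ?cl (fst p, \<sigma> (snd p)))" by (simp add: o_def)
      have "continuous_map ?D Y (\<lambda>p. h' (fst p))"
        using continuous_map_compose[OF continuous_map_fst ch(2)] by (simp add: o_def)
      moreover have "continuous_map ?D euclideanreal (\<lambda>p. 1 + \<sigma> (snd p))"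
        by (intro continuous_map_add cont\<sigma>) auto
      ultimately have "continuous_map (subtopology ?D {p \<in> topspace ?D. \<sigma> (snd p) \<le> 0}) ?P (\<lambda>p. (h' (fst p), 1 + \<sigma> (snd p)))"
      proof (intro toP continuous_map_from_subtopology)
        show "0 \<le> 1 + \<sigma> (snd p) \<and> 1 + \<sigma> (snd p) \<le> 1" if "p \<in> topspace (subtopology ?D {p \<in> topspace ?D. \<sigma> (snd p) \<le> 0})" for p
          using \<sigma>b[of "snd p"] that by simp
      qed
      from continuous_map_compose[OF this cq]
      show "continuous_map (subtopology ?D {p \<in> topspace ?D. \<sigma> (snd p) \<le> 0}) (mapping_torus Y h)
         (\<lambda>p. ?cl (h' (fst p), 1 + \<sigma> (snd p)))" by (simp add: o_def)
      show "?cl (fst p, \<sigma> (snd p)) = ?cl (h' (fst p), 1 + \<sigma> (snd p))"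
        if "p \<in> topspace ?D" "0 = \<sigma> (snd p)" for p
        using that hh hY torus_class_eq_iff[OF hm, of "fst p" "h' (fst p)" 0 1] by auto
    qed auto
    have opn: "open_map ?D (mapping_torus Y h) e"
      unfolding open_map_def
    proof (intro allI impI)
      fix V assume V: "openin ?D V"
      have VD: "z \<in> topspace Y" if "(z, r) \<in> V" for z r using openin_subset[OF V] that by auto
      \<comment> \<open>the image stays away from the time \<open>1/2\<close>, so its preimage falls into two pieces, one at each end\<close>
      have eq: "{p \<in> topspace Y \<times> {0..1}. ?cl p \<in> e ` V} =
          {p \<in> topspace Y \<times> {0..<1/2}. (fst p, \<tau> (snd p)) \<in> V} \<union>
          {p \<in> topspace Y \<times> {1/2<..1}. (h (fst p), \<tau> (snd p - 1)) \<in> V}" (is "?L = ?R1 \<union> ?R2")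
      proof
        show "?L \<subseteq> ?R1 \<union> ?R2"
        proof
          fix p assume "p \<in> ?L"
          then obtain z s z' r where p: "p = (z, s)" "z \<in> topspace Y" "s \<in> {0..1}"
            "?cl (z, s) = e (z', r)" "(z', r) \<in> V" by auto
          show "p \<in> ?R1 \<union> ?R2"
          proof (cases "0 \<le> \<sigma> r")
            case True
            then have "z = z' \<and> s = \<sigma> r \<or> s = 1 \<and> \<sigma> r = 0 \<and> z' = h z"
              using torus_class_eq_iff[OF hm p(2) VD[OF p(5)] p(3), of "\<sigma> r"] \<sigma>b[of r] p(4) by (auto simp: e)
            then show ?thesis using p \<sigma>(4)[of r] \<sigma>b[of r] True by auto
          next
            case False
            then have "z = h' z' \<and> s = 1 + \<sigma> r"
              using torus_class_eq_iff[OF hm p(2) hY(2)[OF VD[OF p(5)]] p(3), of "1 + \<sigma> r"] \<sigma>b[of r] p(4)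
              by (auto simp: e)
            then show ?thesis using p \<sigma>(4)[of r] \<sigma>b[of r] False hh[OF VD[OF p(5)]] by auto
          qed
        qed
        have "?cl p \<in> e ` V" if "p \<in> ?R1" for p
        proof -
          have "e (fst p, \<tau> (snd p)) = ?cl p"
            using \<sigma>(5)[of "snd p"] that by (auto simp: e)
          then show ?thesis using that by (metis (no_types, lifting) imageI mem_Collect_eq)
        qed
        moreover have "?cl p \<in> e ` V" if "p \<in> ?R2" for p
        proof -
          have Y: "fst p \<in> topspace Y" using that by auto
          have "e (h (fst p), \<tau> (snd p - 1)) = ?cl p"
            using \<sigma>(5)[of "snd p - 1"] that h'h[OF Y]
              torus_class_eq_iff[OF hm hY(1)[OF Y] Y, of 0 1] by (auto simp: e)
          then show ?thesis using that by (metis (no_types, lifting) imageI mem_Collect_eq)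
        qed
        ultimately show "?R1 \<union> ?R2 \<subseteq> ?L" by auto
      qed
      have "openin ?P ?R1"
      proof (rule pre[OF _ _ V])
        show "openin (top_of_set {0..1}) {0..<1/2::real}"
          by (auto simp: openin_open intro!: exI[of _ "{..<1/2}"])
        show "continuous_map (subtopology ?P (topspace Y \<times> {0..<1/2})) ?D (\<lambda>p. (fst p, \<tau> (snd p)))"
          by (intro continuous_map_pairedI fstP continuous_map_snd_interval[OF \<sigma>(2)]) auto
      qed
      moreover have "openin ?P ?R2"
      proof (rule pre[OF _ _ V])
        show "openin (top_of_set {0..1}) {1/2<..1::real}"
          by (auto simp: openin_open intro!: exI[of _ "{1/2<..}"])
        have 1: "continuous_on {1/2<..1} (\<lambda>s. \<tau> (s - 1))"
          by (rule continuous_on_compose2[OF \<sigma>(2)]) (auto intro!: continuous_intros)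
        have 2: "continuous_map (subtopology ?P (topspace Y \<times> {1/2<..1})) Y (\<lambda>p. h (fst p))"
          using continuous_map_compose[OF fstP ch(1)] by (simp add: o_def)
        show "continuous_map (subtopology ?P (topspace Y \<times> {1/2<..1})) ?D (\<lambda>p. (h (fst p), \<tau> (snd p - 1)))"
          by (intro continuous_map_pairedI 2 continuous_map_snd_interval[OF 1]) auto
      qed
      moreover have "e ` V \<subseteq> ?cl ` (topspace Y \<times> {0..1})"
      proof clarify
        fix z r assume "(z, r) \<in> V"
        then have "z \<in> topspace Y" using VD by blast
        then have z: "z \<in> topspace Y" "h' z \<in> topspace Y" using hY by auto
        show "e (z, r) \<in> ?cl ` (topspace Y \<times> {0..1})"
        proof (cases "0 \<le> \<sigma> r")
          case True
          show ?thesis unfolding e if_P[OF True] using True \<sigma>b[of r] z by (intro imageI) simp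
        next
          case False
          show ?thesis unfolding e if_not_P[OF False] using False \<sigma>b[of r] z by (intro imageI) simp
        qed
      qed
      ultimately show "openin (mapping_torus Y h) (e ` V)" using op eq by (simp add: openin_Un)
    qed
    have "inj_on e (topspace Y \<times> UNIV)"
    proof (rule inj_onI; clarify)
      fix z r z' r' assume *: "z \<in> topspace Y" "z' \<in> topspace Y" "e (z, r) = e (z', r')"
      \<comment> \<open>on representatives with time in \<open>[0, 1)\<close> the quotient map is injective\<close>
      define a where "a = (if 0 \<le> \<sigma> r then z else h' z)"
      define a' where "a' = (if 0 \<le> \<sigma> r' then z' else h' z')"
      define s where "s = (if 0 \<le> \<sigma> r then \<sigma> r else 1 + \<sigma> r)"
      define s' where "s' = (if 0 \<le> \<sigma> r' then \<sigma> r' else 1 + \<sigma> r')"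
      have "a \<in> topspace Y" "a' \<in> topspace Y" "s \<in> {0..1}" "s' \<in> {0..1}" "s \<noteq> 1" "s' \<noteq> 1"
        "?cl (a, s) = ?cl (a', s')"
        using * hY \<sigma>b[of r] \<sigma>b[of r'] by (auto simp: a_def a'_def s_def s'_def e)
      then have "a = a' \<and> s = s'" using torus_class_eq_iff[OF hm] by blast
      then have "z = z' \<and> \<sigma> r = \<sigma> r'"
        using *(1,2) \<sigma>b[of r] \<sigma>b[of r'] hh unfolding a_def a'_def s_def s'_def
        by (auto split: if_splits) (metis)+
      then show "z = z' \<and> r = r'" using \<sigma>(4) by metis
    qed
    moreover have "e (y, \<tau> 0) = ?cl (y, t)"
      using \<sigma>(5)[of 0] True by (simp add: e)
    ultimately show thesis using that cont opn by blast
  qed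
qed

section \<open>The frontier of a regular neighbourhood\<close>

lemma cone_rel_Image_pos:
  assumes "i \<in> L" "0 < s" "s \<le> 1"
  shows "cone_rel L {0..1} `` {(i, s)} = {(i, s)}"
  using assms by (auto simp: cone_rel_def)

lemma closed_cone_cases:
  assumes "y \<in> topspace (closed_cone L)"
  obtains "y = cone_point L" | i s where "i \<in> L" "0 < s" "s \<le> 1" "y = {(i, s)}"
proof -
  obtain i s where ps: "i \<in> L" "0 \<le> s" "s \<le> 1" "y = cone_rel L {0..1} `` {(i, s)}"
    using assms by (auto simp: closed_cone_def cone_on_def topspace_quotient_topology quotient_def)
  show thesis
  proof (cases "s = 0")
    case True
    then show thesis using ps cone_classes(2)[of i L] that(1) by simp
  next
    case False
    then show thesis using ps cone_rel_Image_pos[of i L s] that(2)[of i s] by simp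
  qed
qed

lemma closed_cone_branch:
  assumes "i \<in> L"
  shows "continuous_map (top_of_set {0<..1}) (closed_cone L) (\<lambda>s. {(i, s)})"
    and "open_map (top_of_set {0<..1}) (closed_cone L) (\<lambda>s. {(i, s)})"
proof -
  let ?P = "prod_topology (discrete_topology L) (top_of_set {0..1::real})"
  let ?q = "\<lambda>p. cone_rel L {0..1} `` {p}"
  have q: "quotient_map ?P (closed_cone L) ?q"
    unfolding closed_cone_def cone_on_def by (rule quotient_map_quotient_topology)
  have op: "openin (closed_cone L) U"
    if "U \<subseteq> topspace (closed_cone L)" "openin ?P {p \<in> topspace ?P. ?q p \<in> U}" for U
    using q that unfolding quotient_map_def by simp
  have "continuous_map (top_of_set {0<..1::real}) ?P (\<lambda>s. (i, s))"
    using assms by (intro continuous_map_pairedI) (auto simp: continuous_map_in_subtopology)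
  from continuous_map_compose[OF this quotient_imp_continuous_map[OF q]]
  have "continuous_map (top_of_set {0<..1}) (closed_cone L) (\<lambda>s. ?q (i, s))"
    by (simp add: o_def)
  then show "continuous_map (top_of_set {0<..1}) (closed_cone L) (\<lambda>s. {(i, s)})"
    by (rule continuous_map_eq) (use assms cone_rel_Image_pos in auto)
  show "open_map (top_of_set {0<..1}) (closed_cone L) (\<lambda>s. {(i, s)})"
    unfolding open_map_def
  proof (intro allI impI)
    fix U :: "real set" assume U: "openin (top_of_set {0<..1}) U"
    then have U01: "U \<subseteq> {0<..1}" using openin_imp_subset by blast
    have eq: "{p \<in> topspace ?P. ?q p \<in> (\<lambda>s. {(i, s)}) ` U} = {i} \<times> U"
    proof (intro set_eqI iffI)
      fix p assume "p \<in> {p \<in> topspace ?P. ?q p \<in> (\<lambda>s. {(i, s)}) ` U}"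
      then obtain s where p: "p \<in> L \<times> {0..1}" "s \<in> U" "?q p = {(i, s)}" by auto
      have "p \<in> ?q p" using p(1) by (auto simp: cone_rel_def)
      then show "p \<in> {i} \<times> U" using p by auto
    next
      fix p assume "p \<in> {i} \<times> U"
      then obtain s where s: "p = (i, s)" "s \<in> U" by auto
      then have "0 < s" "s \<le> 1" using U01 by auto
      then show "p \<in> {p \<in> topspace ?P. ?q p \<in> (\<lambda>s. {(i, s)}) ` U}"
        using s assms cone_rel_Image_pos[of i L s] by auto
    qed
    have "openin (top_of_set {0..1::real}) {0<..1}"
      by (auto simp: openin_open intro!: exI[of _ "{0<..}"])
    moreover have "top_of_set {0<..1::real} = subtopology (top_of_set {0..1}) {0<..1}"
      by (auto simp: subtopology_subtopology intro!: arg_cong[of _ _ "subtopology euclidean"])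
    ultimately have "openin (top_of_set {0..1}) U"
      using U openin_trans_full by metis
    then have "openin ?P ({i} \<times> U)" using assms by (simp add: openin_prod_Times_iff)
    moreover have "(\<lambda>s. {(i, s)}) ` U \<subseteq> topspace (closed_cone L)"
    proof clarify
      fix s assume "s \<in> U"
      then have "0 < s" "s \<le> 1" using U01 by auto
      then show "{(i, s)} \<in> topspace (closed_cone L)"
        using \<open>continuous_map _ _ (\<lambda>s. {(i, s)})\<close> by (auto simp: continuous_map_def)
    qed
    ultimately show "openin (closed_cone L) ((\<lambda>s. {(i, s)}) ` U)"
      using op eq by simp
  qed
qed

lemma open_map_prod_swap:
  assumes "open_map Y Z f"
  shows "open_map (prod_topology X Y) (prod_topology Z X) (\<lambda>p. (f (snd p), fst p))"
  unfolding open_map_def openin_prod_topology_alt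
proof (intro allI impI)
  fix W z x
  assume W: "\<forall>x y. (x, y) \<in> W \<longrightarrow> (\<exists>U V. openin X U \<and> openin Y V \<and> x \<in> U \<and> y \<in> V \<and> U \<times> V \<subseteq> W)"
    and "(z, x) \<in> (\<lambda>p. (f (snd p), fst p)) ` W"
  then obtain y where y: "(x, y) \<in> W" "z = f y" by auto
  then obtain U V where UV: "openin X U" "openin Y V" "x \<in> U" "y \<in> V" "U \<times> V \<subseteq> W"
    using W[rule_format, OF y(1)] by auto
  have "f ` V \<times> U \<subseteq> (\<lambda>p. (f (snd p), fst p)) ` W"
  proof clarify
    fix v u assume "v \<in> V" "u \<in> U"
    then have "(u, v) \<in> W" using UV(5) by auto
    then show "(f v, u) \<in> (\<lambda>p. (f (snd p), fst p)) ` W" by (rule rev_image_eqI) simp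
  qed
  moreover have "openin Z (f ` V)" using assms UV(2) by (simp add: open_map_def)
  ultimately show "\<exists>U V. openin Z U \<and> openin X V \<and> z \<in> U \<and> x \<in> V \<and>
      U \<times> V \<subseteq> (\<lambda>p. (f (snd p), fst p)) ` W"
    using UV(1,3,4) y(2) by (intro exI[of _ "f ` V"] exI[of _ U]) auto
qed

text \<open>Along a branch of the cone, a chart \<open>Y \<times> \<real>\<close> restricts to \<open>(0, 1] \<times> \<real>\<close>. Swapping the factors and
  reversing the height moves the base to height \<open>0\<close>, where a boundary chart expects it.\<close>
lemma mapping_torus_half_plane_chart:
  assumes hm: "homeomorphic_map (closed_cone L) (closed_cone L) h"
    and i: "i \<in> L" and s: "0 < s" "s \<le> 1" and t: "0 \<le> t" "t < 1"
  obtains G r where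
    "continuous_map (top_of_set ((UNIV :: real set) \<times> {0..<1::real})) (mapping_torus (closed_cone L) h) G"
    "open_map (top_of_set ((UNIV :: real set) \<times> {0..<1::real})) (mapping_torus (closed_cone L) h) G"
    "inj_on G ((UNIV :: real set) \<times> {0..<1::real})"
    "G (r, 1 - s) = torus_rel (closed_cone L) h `` {({(i, s)}, t)}"
proof -
  let ?Y = "closed_cone L"
  have iY: "{(i, s)} \<in> topspace ?Y" if "0 < s" "s \<le> 1" for s
    using closed_cone_branch(1)[OF i] that by (auto simp: continuous_map_def)
  obtain e r where e: "continuous_map (prod_topology ?Y euclideanreal) (mapping_torus ?Y h) e"
    "open_map (prod_topology ?Y euclideanreal) (mapping_torus ?Y h) e"
    "inj_on e (topspace ?Y \<times> UNIV)" "e ({(i, s)}, r) = torus_rel ?Y h `` {({(i, s)}, t)}"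
    using mapping_torus_chart[OF hm iY[OF s] t] by metis
  have "homeomorphic_maps (top_of_set {0..<1}) (top_of_set {0<..1}) (\<lambda>u::real. 1 - u) (\<lambda>s. 1 - s)"
    by (auto simp: homeomorphic_maps_def continuous_map_in_subtopology intro!: continuous_intros)
  then have rev: "homeomorphic_map (top_of_set {0..<1}) (top_of_set {0<..1}) (\<lambda>u::real. 1 - u)"
    using homeomorphic_map_maps by blast
  define k where "k = (\<lambda>s. {(i, s)}) \<circ> (\<lambda>u::real. 1 - u)"
  have k: "continuous_map (top_of_set {0..<1}) ?Y k" "open_map (top_of_set {0..<1}) ?Y k"
    unfolding k_def
    using continuous_map_compose[OF homeomorphic_imp_continuous_map[OF rev] closed_cone_branch(1)[OF i]]
      open_map_compose[OF homeomorphic_imp_open_map[OF rev] closed_cone_branch(2)[OF i]] by auto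
  define G where "G = e \<circ> (\<lambda>p. (k (snd p), fst p))"
  have "continuous_map (prod_topology euclideanreal (top_of_set {0..<1})) ?Y (k \<circ> snd)"
    by (rule continuous_map_compose[OF continuous_map_snd k(1)])
  then have "continuous_map (prod_topology euclideanreal (top_of_set {0..<1}))
      (prod_topology ?Y euclideanreal) (\<lambda>p. (k (snd p), fst p))"
    by (intro continuous_map_pairedI continuous_map_fst) (simp add: o_def)
  then have 1: "continuous_map (top_of_set (UNIV \<times> {0..<1})) (mapping_torus ?Y h) G"
    unfolding G_def half_plane_topology[symmetric] using e(1) by (rule continuous_map_compose)
  have 2: "open_map (top_of_set (UNIV \<times> {0..<1})) (mapping_torus ?Y h) G"
    unfolding G_def half_plane_topology[symmetric]
    by (rule open_map_compose[OF open_map_prod_swap[OF k(2)] e(2)])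
  have 3: "inj_on G (UNIV \<times> {0..<1})"
  proof (rule inj_onI; clarify)
    fix a a' u u' :: real
    assume u: "u \<in> {0..<1}" "u' \<in> {0..<1}" and eq: "G (a, u) = G (a', u')"
    have "k u \<in> topspace ?Y" "k u' \<in> topspace ?Y"
      using u iY by (auto simp: k_def)
    moreover have "e (k u, a) = e (k u', a')" using eq by (simp add: G_def)
    ultimately have "(k u, a) = (k u', a')" using e(3) by (simp add: inj_on_def)
    then show "a = a' \<and> u = u'" by (simp add: k_def)
  qed
  have "G (r, 1 - s) = torus_rel ?Y h `` {({(i, s)}, t)}"
    using e(4) by (simp add: G_def k_def)
  then show thesis by (rule that[OF 1 2 3])
qed

lemma compact_space_quotient_topology:
  assumes "compact_space X"
  shows "compact_space (quotient_topology X R)"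
proof -
  have "compactin X (topspace X)" using assms by (simp add: compact_space_def)
  from image_compactin[OF this quotient_imp_continuous_map[OF quotient_map_quotient_topology[of X R]]]
  show ?thesis
    using quotient_imp_surjective_map[OF quotient_map_quotient_topology[of X R]]
    by (simp add: compact_space_def)
qed

lemma compact_space_closed_cone: "finite L \<Longrightarrow> compact_space (closed_cone L)"
  unfolding closed_cone_def cone_on_def
  by (intro compact_space_quotient_topology)
    (simp add: compact_space_prod_topology compact_space_subtopology compact_space_discrete_topology)

lemma compact_space_mapping_torus: "compact_space Y \<Longrightarrow> compact_space (mapping_torus Y h)"
  unfolding mapping_torus_def
  by (intro compact_space_quotient_topology)
    (simp add: compact_space_prod_topology compact_space_subtopology)

lemma nbhd_boundaryI:
  assumes G: "continuous_map (top_of_set ((UNIV :: real set) \<times> {0..<1::real})) (subtopology X N) G"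
    "open_map (top_of_set ((UNIV :: real set) \<times> {0..<1::real})) (subtopology X N) G"
    "inj_on G ((UNIV :: real set) \<times> {0..<1::real})"
  shows "G (a, 0) \<in> nbhd_boundary X N"
proof -
  let ?H = "UNIV \<times> {0..<1::real} :: (real \<times> real) set"
  have GN: "G ` ?H \<subseteq> N" using G(1) by (auto simp: continuous_map_in_subtopology)
  have "embedding_map (top_of_set ?H) (subtopology X N) G"
    using G by (intro injective_open_imp_embedding_map) auto
  then have "homeomorphic_map (top_of_set ?H) (subtopology X (G ` ?H)) G"
    using GN by (simp add: embedding_map_def subtopology_subtopology inf.absorb2)
  then obtain f where f: "homeomorphic_maps (top_of_set ?H) (subtopology X (G ` ?H)) G f"
    using homeomorphic_map_maps by blast
  then have hf: "homeomorphic_map (subtopology X (G ` ?H)) (top_of_set ?H) f"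
    using homeomorphic_maps_map by blast
  have "openin (subtopology X N) (G ` ?H)"
    using G(2) by (simp add: open_map_def)
  moreover have "(a, 0) \<in> ?H" by simp
  moreover from this have "f (G (a, 0)) = (a, 0)"
    using f by (simp add: homeomorphic_maps_def)
  ultimately show ?thesis
    using GN hf unfolding nbhd_boundary_def half_plane_topology
    by (intro CollectI conjI exI[of _ "G ` ?H"] exI[of _ f]) auto
qed

text \<open>
  The members of \<open>\<B>\<close> are the arcs swept by the base points, so their union is the manifold boundary
  of \<open>N\<close>. A class of height \<open>1\<close> is first rewritten as one of height \<open>0\<close>, since the charts cover the
  times in \<open>[0, 1)\<close>. The base does not meet the core: \<open>h\<close> already maps the base points onto the base
  points, so by injectivity it maps no other point, in particular not the cone point, to one of them.
\<close>
lemma regular_neighbourhood_structure: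
  assumes X: "Hausdorff_space X" and reg: "regular_neighbourhood X C N"
  obtains \<B> where "closedin X N" "finite \<B>" "\<And>D. D \<in> \<B> \<Longrightarrow> connectedin X D"
    "\<Union>\<B> \<subseteq> nbhd_boundary X N - C"
    "\<And>x. x \<in> N - C - \<Union>\<B> \<Longrightarrow> \<exists>G z. continuous_map (top_of_set ((UNIV :: real set) \<times> {0..<1::real})) X G \<and>
       inj_on G (UNIV \<times> {0..<1}) \<and> G ` (UNIV \<times> {0..<1}) \<subseteq> N \<and> z \<in> UNIV \<times> {0<..<1} \<and> x = G z"
proof -
  let ?H = "UNIV \<times> {0..<1::real} :: (real \<times> real) set"
  obtain d h \<pi> \<phi> where NX: "N \<subseteq> topspace X" and L: "homeomorphic_map (closed_cone {1..d}) (closed_cone {1..d}) h"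
    "\<pi> permutes {1..d}" "\<And>i. i \<in> {1..d} \<Longrightarrow> h (base_point i) = base_point (\<pi> i)"
    "homeomorphic_map (mapping_torus (closed_cone {1..d}) h) (subtopology X N) \<phi>"
    "\<phi> ` ((\<lambda>t. torus_rel (closed_cone {1..d}) h `` {(cone_point {1..d}, t)}) ` {0..1}) = C"
    "C \<subseteq> X interior_of N"
    using reg unfolding regular_neighbourhood_def Let_def by blast
  define L where "L = {1..d}"
  define Y where "Y = closed_cone L"
  define cl where "cl y t = torus_rel Y h `` {(y, t)}" for y t
  note L = L[folded L_def, folded Y_def]
  let ?T = "mapping_torus Y h"
  have C: "C = (\<lambda>t. \<phi> (cl (cone_point L) t)) ` {0..1}"
    using L(5) by (simp add: image_image cl_def)
  have topT: "topspace ?T = (\<lambda>p. cl (fst p) (snd p)) ` (topspace Y \<times> {0..1})"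
    by (auto simp: mapping_torus_def topspace_quotient_topology quotient_def cl_def)
  have clT: "cl y t \<in> topspace ?T" if "y \<in> topspace Y" "t \<in> {0..1}" for y t
    unfolding topT using that by (intro image_eqI[of _ _ "(y, t)"]) auto
  have phiN: "\<phi> ` topspace ?T = N"
    using homeomorphic_imp_surjective_map[OF L(4)] NX by auto
  have inj: "inj_on \<phi> (topspace ?T)" by (rule homeomorphic_imp_injective_map[OF L(4)])
  have phiX: "continuous_map ?T X \<phi>"
    using homeomorphic_imp_continuous_map[OF L(4)] continuous_map_into_fulltopology by blast
  have hY: "h y \<in> topspace Y" if "y \<in> topspace Y" for y
    using homeomorphic_imp_surjective_map[OF L(1)] that by blast
  have hinj: "inj_on h (topspace Y)" by (rule homeomorphic_imp_injective_map[OF L(1)])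
  have branchY: "{(i, s)} \<in> topspace Y" if "i \<in> L" "0 < s" "s \<le> 1" for i s
    using closed_cone_branch(1)[OF that(1)] that by (auto simp: continuous_map_def Y_def)
  have coneY: "cone_point L \<in> topspace Y" if "i \<in> L" for i
  proof -
    have "cone_rel L {0..1} `` {(i, 0)} \<in> topspace Y"
      using that unfolding Y_def closed_cone_def cone_on_def topspace_quotient_topology
      by (intro quotientI) auto
    then show ?thesis using cone_classes(2)[OF that] by simp
  qed
  have base_ne: "base_point i \<noteq> cone_point L" for i
  proof
    assume "base_point i = cone_point L"
    moreover have "(i, 1) \<in> base_point i" by (simp add: base_point_def)
    ultimately show False by (simp add: cone_point_def)
  qed
  have baseY: "base_point i \<in> topspace Y" if "i \<in> L" for i
    using branchY[OF that, of 1] by (simp add: base_point_def)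
  have turn: "cl y 1 = cl (h y) 0" if "y \<in> topspace Y" for y
    using torus_class_eq_iff[OF L(1), of y "h y" 1 0] that hY by (simp add: cl_def)
  have chart: "\<exists>G r. continuous_map (top_of_set ?H) (subtopology X N) G \<and>
      open_map (top_of_set ?H) (subtopology X N) G \<and> inj_on G ?H \<and> G (r, 1 - s) = \<phi> (cl {(i, s)} t)"
    if ist: "i \<in> L" "0 < s" "s \<le> 1" "0 \<le> t" "t < 1" for i s t
  proof -
    obtain G r where G: "continuous_map (top_of_set ?H) ?T G" "open_map (top_of_set ?H) ?T G"
      "inj_on G ?H" "G (r, 1 - s) = cl {(i, s)} t"
      by (rule mapping_torus_half_plane_chart[OF L(1)[unfolded Y_def] ist, folded Y_def, folded cl_def])
    have "G ` ?H \<subseteq> topspace ?T" using continuous_map_image_subset_topspace[OF G(1)] by simp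
    then have "inj_on (\<phi> \<circ> G) ?H"
      using G(3) inj by (intro comp_inj_on) (auto intro: inj_on_subset)
    then show ?thesis
      using continuous_map_compose[OF G(1) homeomorphic_imp_continuous_map[OF L(4)]]
        open_map_compose[OF G(2) homeomorphic_imp_open_map[OF L(4)]] G(4)
      by (intro exI[of _ "\<phi> \<circ> G"] exI[of _ r]) simp
  qed
  define \<B> where "\<B> = (\<lambda>i. (\<lambda>t. \<phi> (cl (base_point i) t)) ` {0..1}) ` L"
  show thesis
  proof
    show "closedin X N"
    proof (rule compactin_imp_closedin[OF X])
      have "compactin ?T (topspace ?T)"
        using compact_space_mapping_torus[OF compact_space_closed_cone[of L]]
        by (simp add: Y_def L_def compact_space_def)
      from image_compactin[OF this phiX] show "compactin X N" using phiN by simp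
    qed
    show "finite \<B>" by (simp add: \<B>_def L_def)
    show "connectedin X D" if D: "D \<in> \<B>" for D
    proof -
      obtain i where i: "i \<in> L" "D = (\<lambda>t. \<phi> (cl (base_point i) t)) ` {0..1}"
        using D by (auto simp: \<B>_def)
      have "continuous_map (top_of_set {0..1}) (prod_topology Y (top_of_set {0..1})) (\<lambda>t. (base_point i, t))"
        using baseY[OF i(1)] by (intro continuous_map_pairedI) auto
      moreover have "continuous_map (prod_topology Y (top_of_set {0..1})) ?T (\<lambda>p. torus_rel Y h `` {p})"
        unfolding mapping_torus_def by (rule quotient_imp_continuous_map[OF quotient_map_quotient_topology])
      ultimately have "continuous_map (top_of_set {0..1}) ?T (\<lambda>t. cl (base_point i) t)"
        unfolding cl_def using continuous_map_compose by (fastforce simp: o_def)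
      from continuous_map_compose[OF this phiX]
      have "continuous_map (top_of_set {0..1}) X (\<lambda>t. \<phi> (cl (base_point i) t))" by (simp add: o_def)
      moreover have "connectedin (top_of_set {0..1::real}) {0..1}"
        by (simp add: connectedin_subtopology)
      ultimately show ?thesis unfolding i(2) by (rule connectedin_continuous_map_image)
    qed
    show "\<Union>\<B> \<subseteq> nbhd_boundary X N - C"
    proof
      fix x assume "x \<in> \<Union>\<B>"
      then obtain i0 t0 where 0: "i0 \<in> L" "t0 \<in> {0..1}" "x = \<phi> (cl (base_point i0) t0)"
        by (auto simp: \<B>_def)
      obtain i t where it: "i \<in> L" "0 \<le> t" "t < 1" "x = \<phi> (cl (base_point i) t)"
      proof (cases "t0 = 1")
        case True
        show thesis
          using 0 turn[OF baseY[OF 0(1)]] L(3)[OF 0(1)] True permutes_in_image[OF L(2)]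
          by (intro that[of "\<pi> i0" 0]) auto
      qed (use 0 that[of i0 t0] in auto)
      from chart[OF it(1), of 1 t] it(2,3) obtain G r where
        G: "continuous_map (top_of_set ?H) (subtopology X N) G" "open_map (top_of_set ?H) (subtopology X N) G"
          "inj_on G ?H" "G (r, 0) = x"
        using it(4) by (auto simp: base_point_def)
      have "x \<in> nbhd_boundary X N"
        using nbhd_boundaryI[OF G(1-3), of r] G(4) by simp
      moreover have "x \<notin> C"
      proof
        assume "x \<in> C"
        then obtain t' where t': "t' \<in> {0..1}" "x = \<phi> (cl (cone_point L) t')" unfolding C by blast
        \<comment> \<open>for \<open>t < 1\<close> the only identification left is with time \<open>t' = 1\<close>\<close>
        have "cl (base_point i) t = cl (cone_point L) t'"
          using inj_onD[OF inj] t' it clT baseY coneY by auto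
        then have "t = 0 \<and> t' = 1 \<and> base_point i = h (cone_point L)"
          using torus_class_eq_iff[OF L(1) baseY[OF it(1)] coneY[OF it(1)], of t t'] it t' base_ne
          by (auto simp: cl_def)
        moreover obtain j where j: "j \<in> L" "\<pi> j = i"
          using L(2) it(1) by (metis permutes_image imageE)
        ultimately have "h (base_point j) = h (cone_point L)" using L(3)[OF j(1)] by simp
        then have "base_point j = cone_point L"
          using inj_onD[OF hinj] baseY coneY j(1) by blast
        then show False using base_ne by blast
      qed
      ultimately show "x \<in> nbhd_boundary X N - C" by blast
    qed
    show "\<exists>G z. continuous_map (top_of_set ?H) X G \<and> inj_on G ?H \<and> G ` ?H \<subseteq> N \<and>
        z \<in> UNIV \<times> {0<..<1} \<and> x = G z" if x: "x \<in> N - C - \<Union>\<B>" for x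
    proof -
      obtain y0 t0 where 0: "y0 \<in> topspace Y" "t0 \<in> {0..1}" "x = \<phi> (cl y0 t0)"
        using x phiN topT by auto
      obtain y t where yt: "y \<in> topspace Y" "0 \<le> t" "t < 1" "x = \<phi> (cl y t)"
      proof (cases "t0 = 1")
        case True
        show thesis using 0 turn[OF 0(1)] True hY[OF 0(1)] by (intro that[of "h y0" 0]) auto
      qed (use 0 that[of y0 t0] in auto)
      have "y \<noteq> cone_point L" using x yt unfolding C by auto
      then obtain i s where ps: "i \<in> L" "0 < s" "s \<le> 1" "y = {(i, s)}"
        using closed_cone_cases[of y L] yt(1) unfolding Y_def by blast
      have "s \<noteq> 1"
      proof
        assume "s = 1"
        then have "x = \<phi> (cl (base_point i) t)" using ps yt by (simp add: base_point_def)
        then have "x \<in> (\<lambda>t. \<phi> (cl (base_point i) t)) ` {0..1}"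
          using yt(2,3) by (intro image_eqI[of _ _ t]) auto
        then have "x \<in> \<Union>\<B>" unfolding \<B>_def using ps(1) by blast
        then show False using x by blast
      qed
      obtain G r where G: "continuous_map (top_of_set ?H) (subtopology X N) G" "inj_on G ?H"
          "G (r, 1 - s) = x"
        using chart[OF ps(1-3) yt(2,3)] yt(4) ps(4) by metis
      then show ?thesis
        using ps \<open>s \<noteq> 1\<close> by (intro exI[of _ G] exI[of _ "(r, 1 - s)"])
          (auto simp: continuous_map_in_subtopology)
    qed
  qed
qed

text \<open>Comparison of the manifold boundary of \<open>N\<close> with its frontier in \<open>X\<close>; both inclusions are
  invariance of domain in the planar set \<open>N - C\<close>.\<close>
lemma regular_neighbourhood_frontier:
  assumes X: "Hausdorff_space X" and reg: "regular_neighbourhood X C N"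
    and planar: "\<And>x. x \<in> N - C \<Longrightarrow> planar_at X x"
  obtains \<B> where "closedin X N" "finite \<B>" "\<And>D. D \<in> \<B> \<Longrightarrow> connectedin X D"
    "N - X interior_of N = \<Union>\<B>" "N - X interior_of N \<subseteq> nbhd_boundary X N"
proof -
  have NX: "N \<subseteq> topspace X" and C: "C \<subseteq> X interior_of N"
    using reg by (auto simp: regular_neighbourhood_def)
  obtain \<B> where \<B>: "closedin X N" "finite \<B>" "\<And>D. D \<in> \<B> \<Longrightarrow> connectedin X D"
    "\<Union>\<B> \<subseteq> nbhd_boundary X N - C"
    "\<And>x. x \<in> N - C - \<Union>\<B> \<Longrightarrow> \<exists>G z. continuous_map (top_of_set ((UNIV :: real set) \<times> {0..<1::real})) X G \<and>
       inj_on G (UNIV \<times> {0..<1}) \<and> G ` (UNIV \<times> {0..<1}) \<subseteq> N \<and> z \<in> UNIV \<times> {0<..<1} \<and> x = G z"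
    using regular_neighbourhood_structure[OF X reg] by blast
  have "x \<notin> X interior_of N" if x: "x \<in> \<Union>\<B>" for x
  proof (rule nbhd_boundary_not_interior[OF _ NX])
    show "x \<in> nbhd_boundary X N" using \<B>(4) x by blast
    then have "x \<in> N" by (simp add: nbhd_boundary_def)
    then show "planar_at X x" using planar \<B>(4) x by blast
  qed
  moreover have "x \<in> X interior_of N" if x: "x \<in> N - \<Union>\<B>" for x
  proof (cases "x \<in> C")
    case False
    then obtain G z where G: "continuous_map (top_of_set ((UNIV :: real set) \<times> {0..<1::real})) X G"
       "inj_on G (UNIV \<times> {0..<1})" "G ` (UNIV \<times> {0..<1}) \<subseteq> N" "z \<in> UNIV \<times> {0<..<1}" "x = G z"
      using \<B>(5)[of x] x by blast
    let ?O = "(UNIV :: real set) \<times> {0<..<1::real}"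
    have sub: "?O \<subseteq> UNIV \<times> {0..<1}" by auto
    have "openin X {x \<in> G ` ?O. planar_at X x}"
      using continuous_map_from_subtopology_mono[OF G(1) sub] inj_on_subset[OF G(2) sub]
      by (rule planar_image_openin) (simp add: open_Times)
    moreover have "{x \<in> G ` ?O. planar_at X x} \<subseteq> N" using G(3) sub by blast
    moreover have "x \<in> {x \<in> G ` ?O. planar_at X x}" using planar[of x] x False G(4,5) by blast
    ultimately show ?thesis using interior_of_maximal by blast
  qed (use C in blast)
  moreover have "\<Union>\<B> \<subseteq> N" using \<B>(4) by (auto simp: nbhd_boundary_def)
  ultimately have eq: "N - X interior_of N = \<Union>\<B>" by blast
  show thesis
    by (rule that[OF \<B>(1-3) eq]) (use eq \<B>(4) in auto)
qed

section \<open>Connected components\<close>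

text \<open>Every component of the union contains some member \<open>D\<close> of \<open>\<D>\<close>, and it is then the component of
  any point chosen in \<open>D\<close>.\<close>
lemma finite_components_in_Union:
  assumes "finite \<D>" "\<And>D. D \<in> \<D> \<Longrightarrow> connectedin X D" "A = \<Union>\<D>"
  shows "finite (components_in X A)"
proof -
  let ?K = "\<lambda>D. connected_component_of_set (subtopology X A) (SOME x. x \<in> D)"
  have "components_in X A \<subseteq> ?K ` \<D>"
  proof
    fix S assume S: "S \<in> components_in X A"
    then have S': "S \<in> connected_components_of (subtopology X A)" by (simp add: components_in_def)
    have "S \<noteq> {}" using nonempty_connected_components_of[OF S'] .
    moreover have SA: "S \<subseteq> A" using connected_components_of_subset[OF S'] by simp
    ultimately obtain x D where x: "x \<in> S" "x \<in> D" "D \<in> \<D>" using assms(3) by blast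
    then have "(SOME x. x \<in> D) \<in> D" by (metis someI_ex)
    moreover have "D \<subseteq> S"
    proof (rule connected_components_of_maximal[OF S'])
      show "connectedin (subtopology X A) D"
        using assms x(3) by (auto simp: connectedin_subtopology)
      show "\<not> disjnt S D" using x by (auto simp: disjnt_def)
    qed
    ultimately have "(SOME x. x \<in> D) \<in> S" by blast
    then have "S = ?K D"
      using S' by (metis connected_component_in_connected_components_of
          connected_component_of_refl connected_components_of_overlap
          connected_components_of_subset disjoint_iff mem_Collect_eq subsetD)
    then show "S \<in> ?K ` \<D>" using x(3) by blast
  qed
  then show ?thesis using assms(1) finite_surj by blast
qed

lemma components_in_subset:
  assumes S: "S \<in> components_in X F" and "S \<subseteq> A" "A \<subseteq> F"
  shows "S \<in> components_in X A"
proof -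
  have S': "S \<in> connected_components_of (subtopology X F)" using S by (simp add: components_in_def)
  then obtain x where x: "x \<in> S" using nonempty_connected_components_of by blast
  have con: "connectedin X S" and "S \<subseteq> topspace X"
    using connectedin_connected_components_of[OF S'] connectedin_subset_topspace
    by (auto simp: connectedin_subtopology)
  have "connected_component_of_set (subtopology X A) x = S"
  proof (rule connected_component_of_unique[OF x])
    show "connectedin (subtopology X A) S" using con assms(2) by (simp add: connectedin_subtopology)
    fix S' assume *: "x \<in> S' \<and> connectedin (subtopology X A) S'"
    then have "connectedin (subtopology X F) S'" using assms(3) by (auto simp: connectedin_subtopology)
    moreover have "\<not> disjnt S S'" using x * by (auto simp: disjnt_def)
    ultimately show "S' \<subseteq> S" using connected_components_of_maximal[OF \<open>S \<in> connected_components_of _\<close>] by blast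
  qed
  then show ?thesis
    using x assms(2) \<open>S \<subseteq> topspace X\<close> unfolding components_in_def
    by (metis connected_component_in_connected_components_of IntI subsetD topspace_subtopology)
qed

lemma components_in_facts:
  assumes "S \<in> components_in X A"
  shows "S \<noteq> {}" "S \<subseteq> A" "S \<subseteq> topspace X" "connectedin X S" "closedin X A \<Longrightarrow> closedin X S"
proof -
  have S: "S \<in> connected_components_of (subtopology X A)" using assms by (simp add: components_in_def)
  show "S \<noteq> {}" by (rule nonempty_connected_components_of[OF S])
  show "connectedin X S" using connectedin_connected_components_of[OF S] by (simp add: connectedin_subtopology)
  show "S \<subseteq> A" "S \<subseteq> topspace X" using connected_components_of_subset[OF S] by auto
  show "closedin X S" if "closedin X A"
    using closedin_connected_components_of[OF S] that closedin_trans_full by blast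
qed

lemma components_in_disjoint:
  assumes "S \<in> components_in X A" "S' \<in> components_in X A" "S \<noteq> S'"
  shows "S \<inter> S' = {}"
  using assms connected_components_of_overlap unfolding components_in_def by blast

lemma connectedin_subset_component:
  assumes "connectedin X S" "S \<subseteq> A" "S \<noteq> {}"
  obtains W where "W \<in> components_in X A" "S \<subseteq> W"
proof -
  obtain x where x: "x \<in> S" using assms(3) by blast
  have con: "connectedin (subtopology X A) S" using assms by (simp add: connectedin_subtopology)
  then have "x \<in> topspace (subtopology X A)" using x connectedin_subset_topspace by blast
  then show thesis
    using that[of "connected_component_of_set (subtopology X A) x"] connected_component_of_maximal[OF con x]
    unfolding components_in_def by (simp add: connected_component_in_connected_components_of)
qed

lemma connectedin_subset_disjoint_closedin:
  assumes S: "connectedin X S" "S \<noteq> {}" and I: "finite I" "\<And>i. i \<in> I \<Longrightarrow> closedin X (N i)"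
    and dis: "\<And>i j. i \<in> I \<Longrightarrow> j \<in> I \<Longrightarrow> i \<noteq> j \<Longrightarrow> N i \<inter> N j = {}" and sub: "S \<subseteq> (\<Union>i\<in>I. N i)"
  obtains i where "i \<in> I" "S \<subseteq> N i"
proof -
  obtain x i where x: "x \<in> S" "i \<in> I" "x \<in> N i" using S(2) sub by blast
  let ?R = "\<Union>j\<in>I - {i}. N j"
  have "closedin X ?R" using I by (intro closedin_Union) auto
  moreover have "S \<subseteq> N i \<union> ?R" using sub by blast
  moreover have "N i \<inter> ?R = {}"
  proof -
    have "N i \<inter> N j = {}" if "j \<in> I - {i}" for j using dis[OF x(2), of j] that by auto
    then show ?thesis by blast
  qed
  ultimately have "?R \<inter> S = {}"
    using S(1) I(2)[OF x(2)] x unfolding connectedin_closedin by (metis disjoint_iff inf_bot_left)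
  then have "S \<subseteq> N i" using \<open>S \<subseteq> N i \<union> ?R\<close> by blast
  then show thesis using that x(2) by blast
qed

section \<open>The complementary surface and the edges\<close>

locale stratifold_with_neighbourhoods =
  fixes X :: "'a topology" and X1 :: "'a set" and N :: "'a set \<Rightarrow> 'a set"
  assumes stratifold: "two_stratifold X X1" and neighbourhoods: "regular_neighbourhoods X X1 N"
begin

abbreviation curves :: "'a set set" where "curves \<equiv> components_in X X1"
abbreviation surface :: "'a set" where "surface \<equiv> complementary_surface X X1 N"
text \<open>The union of the frontiers of the neighbourhoods; it turns out to be \<open>\<partial>M\<close>.\<close>
definition seam :: "'a set" where "seam = (\<Union>C\<in>curves. N C - X interior_of N C)"

lemma space: "compact_space X" "connected_space X" "Hausdorff_space X" "closedin X X1"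
  "finite curves"
  using stratifold by (auto simp: two_stratifold_def closed_1_manifold_def components_in_def)

lemma planar_off_curves:
  assumes "x \<in> topspace X - X1"
  shows "planar_at X x"
proof -
  have "\<forall>x \<in> topspace X - X1. \<exists>U. neighbourhood_of X x U \<and>
      subtopology X U homeomorphic_space (euclidean :: (real \<times> real) topology)"
    using stratifold unfolding two_stratifold_def by (elim conjE)
  with assms obtain U where "neighbourhood_of X x U"
      "subtopology X U homeomorphic_space (euclidean :: (real \<times> real) topology)"
    by (metis (no_types))
  then show ?thesis by (rule planar_at_if_neighbourhood)
qed

lemma neighbourhood:
  assumes "C \<in> curves"
  shows "regular_neighbourhood X C (N C)" "N C \<subseteq> topspace X" "C \<subseteq> X interior_of N C"
  using assms neighbourhoods by (auto simp: regular_neighbourhoods_def regular_neighbourhood_def)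

lemma curve_subset_neighbourhood: "C \<in> curves \<Longrightarrow> C \<subseteq> N C"
  using neighbourhood(3) interior_of_subset by (rule subset_trans)

lemma neighbourhoods_disjoint: "C \<in> curves \<Longrightarrow> C' \<in> curves \<Longrightarrow> C \<noteq> C' \<Longrightarrow> N C \<inter> N C' = {}"
  using neighbourhoods by (auto simp: regular_neighbourhoods_def)

lemma Union_curves: "\<Union>curves = X1"
  using Union_connected_components_of[of "subtopology X X1"] closedin_subset[OF space(4)]
  by (simp add: components_in_def inf.absorb2)

lemma planar_in_neighbourhood:
  assumes "C \<in> curves" "x \<in> N C - C"
  shows "planar_at X x"
proof (rule planar_off_curves)
  have "x \<notin> X1"
  proof
    assume "x \<in> X1"
    then obtain C' where C': "C' \<in> curves" "x \<in> C'" using Union_curves by blast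
    then have "x \<in> N C'" using curve_subset_neighbourhood by auto
    then show False using assms C' neighbourhoods_disjoint[of C C'] by blast
  qed
  then show "x \<in> topspace X - X1" using assms neighbourhood(2) by blast
qed

lemma neighbourhood_frontier:
  assumes "C \<in> curves"
  obtains \<B> where "closedin X (N C)" "finite \<B>" "\<And>D. D \<in> \<B> \<Longrightarrow> connectedin X D"
    "N C - X interior_of N C = \<Union>\<B>" "N C - X interior_of N C \<subseteq> nbhd_boundary X (N C)"
proof (rule regular_neighbourhood_frontier[OF space(3) neighbourhood(1)[OF assms]])
  show "planar_at X x" if "x \<in> N C - C" for x
    using assms that by (rule planar_in_neighbourhood)
qed (rule that)

lemma closedin_neighbourhood: "C \<in> curves \<Longrightarrow> closedin X (N C)"
  by (rule neighbourhood_frontier)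

lemma closedin_Union_neighbourhoods: "closedin X (\<Union>C\<in>curves. N C)"
  using space(5) closedin_neighbourhood by (intro closedin_Union) auto

lemma frontier_subset_nbhd_boundary: "C \<in> curves \<Longrightarrow> N C - X interior_of N C \<subseteq> nbhd_boundary X (N C)"
  by (rule neighbourhood_frontier)

text \<open>Around a point of \<open>N C\<close> the other neighbourhoods can be removed from any open set, since they
  form a finite family of closed sets disjoint from \<open>N C\<close>.\<close>
lemma interior_of_Union_neighbourhoods:
  "X interior_of (\<Union>C\<in>curves. N C) = (\<Union>C\<in>curves. X interior_of N C)"
proof
  show "(\<Union>C\<in>curves. X interior_of N C) \<subseteq> X interior_of (\<Union>C\<in>curves. N C)"
    by (simp add: UN_least interior_of_mono UN_upper)
  show "X interior_of (\<Union>C\<in>curves. N C) \<subseteq> (\<Union>C\<in>curves. X interior_of N C)"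
  proof
    fix x assume x: "x \<in> X interior_of (\<Union>C\<in>curves. N C)"
    then have "x \<in> (\<Union>C\<in>curves. N C)" using interior_of_subset[of X "\<Union>C\<in>curves. N C"] by auto
    then obtain C where C: "C \<in> curves" "x \<in> N C" by auto
    let ?R = "\<Union>C'\<in>curves - {C}. N C'"
    have "closedin X ?R" using space(5) closedin_neighbourhood by (intro closedin_Union) auto
    then have op: "openin X (X interior_of (\<Union>C\<in>curves. N C) - ?R)" by (simp add: openin_diff)
    have "X interior_of (\<Union>C\<in>curves. N C) - ?R \<subseteq> N C"
      using interior_of_subset[of X "\<Union>C\<in>curves. N C"] by blast
    then have "X interior_of (\<Union>C\<in>curves. N C) - ?R \<subseteq> X interior_of N C"
      using op by (rule interior_of_maximal)
    moreover have "x \<notin> ?R"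
    proof
      assume "x \<in> ?R"
      then obtain C' where "C' \<in> curves" "C' \<noteq> C" "x \<in> N C'" by blast
      then show False using neighbourhoods_disjoint[of C C'] C by blast
    qed
    ultimately show "x \<in> (\<Union>C\<in>curves. X interior_of N C)" using x C(1) by blast
  qed
qed

lemma surface_eq: "surface = topspace X - (\<Union>C\<in>curves. X interior_of N C)"
  unfolding complementary_surface_def closure_of_complement interior_of_Union_neighbourhoods ..

lemma closedin_surface: "closedin X surface"
  by (simp add: complementary_surface_def)

lemma surface_Int_neighbourhood: "C \<in> curves \<Longrightarrow> surface \<inter> N C = N C - X interior_of N C"
proof
  assume C: "C \<in> curves"
  show "surface \<inter> N C \<subseteq> N C - X interior_of N C" using C by (auto simp: surface_eq)
  show "N C - X interior_of N C \<subseteq> surface \<inter> N C"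
  proof
    fix x assume x: "x \<in> N C - X interior_of N C"
    have "x \<notin> X interior_of N C'" if C': "C' \<in> curves" for C'
    proof (cases "C' = C")
      case False
      then have "x \<notin> N C'" using neighbourhoods_disjoint[OF C C'] x by blast
      then show ?thesis using interior_of_subset[of X "N C'"] by auto
    qed (use x in blast)
    then show "x \<in> surface \<inter> N C" using x neighbourhood(2)[OF C] by (auto simp: surface_eq)
  qed
qed

lemma surface_Int_neighbourhoods: "surface \<inter> (\<Union>C\<in>curves. N C) = seam"
  unfolding seam_def using surface_Int_neighbourhood by blast

lemma seam_subset: "seam \<subseteq> surface" "seam \<subseteq> (\<Union>C\<in>curves. N C)"
  using surface_Int_neighbourhoods by blast+

lemma closedin_seam: "closedin X seam"
proof -
  show ?thesis
    using closedin_Int[OF closedin_surface closedin_Union_neighbourhoods] surface_Int_neighbourhoods by simp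
qed

lemma planar_on_surface: "x \<in> surface \<Longrightarrow> planar_at X x"
proof (rule planar_off_curves)
  assume x: "x \<in> surface"
  have "x \<notin> X1"
  proof
    assume "x \<in> X1"
    then obtain C where "C \<in> curves" "x \<in> C" using Union_curves by blast
    then show False using neighbourhood(3) x by (auto simp: surface_eq)
  qed
  then show "x \<in> topspace X - X1" using x by (simp add: surface_eq)
qed

text \<open>A planar neighbourhood of \<open>x\<close> in \<open>W\<close> is already open in \<open>X\<close>. If \<open>x\<close> lay on the frontier of \<open>N C\<close>,
  that neighbourhood would contain interior points of \<open>N C\<close>, but \<open>M\<close> has none. The argument covers
  \<open>M\<close> and its components alike.\<close>
lemma surface_interior_off_seam:
  assumes W: "W \<subseteq> surface" and x: "x \<in> surface_interior X W"
  shows "x \<notin> seam"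
proof
  assume "x \<in> seam"
  then obtain C where C: "C \<in> curves" "x \<in> N C - X interior_of N C" by (auto simp: seam_def)
  obtain U where U: "openin (subtopology X W) U" "x \<in> U"
    "subtopology X U homeomorphic_space (euclidean :: (real \<times> real) topology)"
    using x by (auto simp: surface_interior_def)
  have "U \<subseteq> W" using openin_subset[OF U(1)] by simp
  then have UM: "U \<subseteq> surface" using W by blast
  have "openin X U"
  proof (rule openin_if_homeomorphic_plane[OF U(3)])
    show "U \<subseteq> topspace X" using UM by (auto simp: surface_eq)
  qed (use UM planar_on_surface in blast)
  moreover have "x \<in> nbhd_boundary X (N C)" using frontier_subset_nbhd_boundary[OF C(1)] C(2) by blast
  moreover have "planar_at X x" using UM U(2) planar_on_surface by blast
  ultimately have "U \<inter> X interior_of N C \<noteq> {}"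
    using nbhd_boundary_adherent_to_interior neighbourhood(2)[OF C(1)] U(2) by metis
  then show False using UM C(1) by (auto simp: surface_eq)
qed

text \<open>A small planar disc around \<open>x\<close> avoids the closed set \<open>\<Union>C. N C\<close> and is connected, so it stays
  inside \<open>W\<close>, and it is open in \<open>W\<close> because it is open in \<open>X\<close>.\<close>
lemma surface_interior_if_off_seam:
  assumes W: "W = surface \<or> W \<in> components_in X surface" and x: "x \<in> W" "x \<notin> seam"
  shows "x \<in> surface_interior X W"
proof -
  have WM: "W \<subseteq> surface" using W components_in_facts(2) by blast
  from closedin_Union_neighbourhoods have opn: "openin X (topspace X - (\<Union>C\<in>curves. N C))" by blast
  have xM: "x \<in> surface" using x WM by blast
  have xN: "x \<in> topspace X - (\<Union>C\<in>curves. N C)"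
    using x WM surface_Int_neighbourhoods closedin_subset[OF closedin_surface] by blast
  obtain Z where Z: "openin X Z" "x \<in> Z" "Z \<subseteq> topspace X - (\<Union>C\<in>curves. N C)"
    "subtopology X Z homeomorphic_space (euclidean :: (real \<times> real) topology)"
    by (rule planar_at_plane_neighbourhood[OF planar_on_surface[OF xM] opn xN])
  have "topspace X - (\<Union>C\<in>curves. N C) \<subseteq> surface"
    unfolding complementary_surface_def by (simp add: closure_of_subset)
  then have ZM: "Z \<subseteq> surface" using Z(3) by blast
  have "connectedin X Z"
  proof -
    have "connected_space (subtopology X Z)"
      using Z(4) homeomorphic_connected_space by (metis connected_UNIV connected_space_subtopology subtopology_UNIV connectedin_iff_connected)
    then show ?thesis using Z(1) by (simp add: connectedin_def openin_subset)
  qed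
  then have "Z \<subseteq> W"
  proof (cases "W = surface")
    case False
    then have "W \<in> connected_components_of (subtopology X surface)" using W by (simp add: components_in_def)
    moreover have "connectedin (subtopology X surface) Z"
      using \<open>connectedin X Z\<close> ZM by (simp add: connectedin_subtopology)
    moreover have "\<not> disjnt W Z" using x(1) Z(2) by (auto simp: disjnt_def)
    ultimately show ?thesis by (rule connected_components_of_maximal)
  qed (use ZM in simp)
  then have "openin (subtopology X W) Z" using Z(1) by (metis inf.absorb1 openin_subtopology)
  then show ?thesis using x(1) Z(2,4) by (auto simp: surface_interior_def)
qed

lemma surface_boundary_eq:
  assumes "W = surface \<or> W \<in> components_in X surface"
  shows "surface_boundary X W = W \<inter> seam"
proof -
  have "W \<subseteq> surface" using assms components_in_facts(2) by blast
  then show ?thesis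
    using surface_interior_off_seam surface_interior_if_off_seam[OF assms]
    unfolding surface_boundary_def by blast
qed

lemma edges_eq: "edges X X1 N = components_in X seam"
  using surface_boundary_eq[of surface] seam_subset(1) by (simp add: edges_def inf.absorb2)

lemma finite_edges: "finite (edges X X1 N)"
proof -
  have "\<exists>\<B>. finite \<B> \<and> (\<forall>D\<in>\<B>. connectedin X D) \<and> N C - X interior_of N C = \<Union>\<B>"
    if "C \<in> curves" for C
    by (rule neighbourhood_frontier[OF that]) blast
  then have "\<exists>\<B>. \<forall>C\<in>curves. finite (\<B> C) \<and> (\<forall>D\<in>\<B> C. connectedin X D) \<and> N C - X interior_of N C = \<Union>(\<B> C)"
    by (intro bchoice ballI)
  then obtain \<B> where all: "\<forall>C\<in>curves. finite (\<B> C) \<and> (\<forall>D\<in>\<B> C. connectedin X D) \<and>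
      N C - X interior_of N C = \<Union>(\<B> C)" by (rule exE)
  have \<B>: "finite (\<B> C)" "N C - X interior_of N C = \<Union>(\<B> C)" "\<And>D. D \<in> \<B> C \<Longrightarrow> connectedin X D"
    if "C \<in> curves" for C
    using bspec[OF all that] by blast+
  have "finite (\<Union>(\<B> ` curves))" using \<B>(1) space(5) by blast
  moreover have "connectedin X D" if "D \<in> \<Union>(\<B> ` curves)" for D using \<B>(3) that by blast
  moreover have "seam = \<Union>(\<Union>(\<B> ` curves))"
  proof -
    have "seam = (\<Union>C\<in>curves. \<Union>(\<B> C))" unfolding seam_def using \<B>(2) by (intro SUP_cong refl)
    then show ?thesis by blast
  qed
  ultimately show ?thesis unfolding edges_eq by (rule finite_components_in_Union)
qed

lemma edge_facts:
  assumes "S \<in> edges X X1 N"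
  shows "closedin X S" "S \<subseteq> seam" "S \<noteq> {}" "connectedin X S"
  using components_in_facts[of S X seam] assms closedin_seam unfolding edges_eq by auto

lemma edges_disjoint: "S \<in> edges X X1 N \<Longrightarrow> S' \<in> edges X X1 N \<Longrightarrow> S \<noteq> S' \<Longrightarrow> S \<inter> S' = {}"
  unfolding edges_eq by (rule components_in_disjoint)

lemma white_facts:
  assumes "W \<in> white_vertices X X1 N"
  shows "closedin X W" "W \<subseteq> surface" "W \<noteq> {}" "W \<in> components_in X surface"
  using components_in_facts[of W X surface] assms closedin_surface unfolding white_vertices_def by auto

lemma white_disjoint: "W \<in> white_vertices X X1 N \<Longrightarrow> W' \<in> white_vertices X X1 N \<Longrightarrow> W \<noteq> W' \<Longrightarrow> W \<inter> W' = {}"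
  unfolding white_vertices_def by (rule components_in_disjoint)

lemma Union_white: "\<Union>(white_vertices X X1 N) = surface"
  using Union_connected_components_of[of "subtopology X surface"]
  by (auto simp: white_vertices_def components_in_def surface_eq)

lemma edge_in_white:
  assumes "S \<in> edges X X1 N"
  obtains W where "W \<in> white_vertices X X1 N" "S \<subseteq> W"
proof (rule connectedin_subset_component[of X S surface])
  show "S \<subseteq> surface" using edge_facts(2)[OF assms] seam_subset(1) by blast
qed (use edge_facts[OF assms] that in \<open>auto simp: white_vertices_def\<close>)

lemma edge_in_neighbourhood:
  assumes "S \<in> edges X X1 N"
  obtains C where "C \<in> curves" "S \<subseteq> N C"
proof (rule connectedin_subset_disjoint_closedin[of X S curves N])
  show "S \<subseteq> (\<Union>C\<in>curves. N C)" using edge_facts(2)[OF assms] seam_subset(2) by blast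
qed (use edge_facts[OF assms] space(5) closedin_neighbourhood neighbourhoods_disjoint that in auto)

lemma white_Int_neighbourhood:
  assumes "W \<in> white_vertices X X1 N" "C \<in> curves"
  shows "W \<inter> N C \<subseteq> seam"
  using white_facts(2)[OF assms(1)] assms(2) surface_Int_neighbourhoods by blast

text \<open>This activates the conditions on the arcs, which are imposed only on pairs that an edge joins.\<close>
lemma edge_joins:
  assumes "S \<in> edges X X1 N" "W \<in> white_vertices X X1 N" "C \<in> curves" "S \<subseteq> W" "S \<subseteq> N C"
  shows "joins X S W (N C)"
  using components_in_subset[of S X seam "W \<inter> N C"] white_Int_neighbourhood[OF assms(2,3)] assms
  by (simp add: joins_def edges_eq)

lemma edge_subset_white:
  assumes "S \<in> edges X X1 N" "W \<in> white_vertices X X1 N" "x \<in> S" "x \<in> W"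
  shows "S \<subseteq> W"
proof -
  obtain W' where "W' \<in> white_vertices X X1 N" "S \<subseteq> W'" using edge_in_white[OF assms(1)] .
  then show ?thesis using white_disjoint[OF assms(2), of W'] assms(3,4) by blast
qed

lemma edge_subset_neighbourhood:
  assumes "S \<in> edges X X1 N" "C \<in> curves" "x \<in> S" "x \<in> N C"
  shows "S \<subseteq> N C"
proof -
  obtain C' where "C' \<in> curves" "S \<subseteq> N C'" using edge_in_neighbourhood[OF assms(1)] .
  then show ?thesis using neighbourhoods_disjoint[OF assms(2), of C'] assms(3,4) by blast
qed

lemma Union_edges: "\<Union>(edges X X1 N) = seam"
  using Union_connected_components_of[of "subtopology X seam"] closedin_subset[OF closedin_seam]
  by (auto simp: edges_eq components_in_def)

text \<open>If \<open>M\<close> is all of \<open>X\<close>, it is connected. Otherwise each component of \<open>M\<close> reaches the frontier of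
  \<open>M\<close> by boundary bumping, hence contains an edge, and distinct components contain distinct edges.\<close>
lemma finite_white_vertices: "finite (white_vertices X X1 N)"
proof (cases "surface = topspace X")
  case True
  then have "white_vertices X X1 N = connected_components_of X"
    by (simp add: white_vertices_def components_in_def)
  also have "\<dots> \<subseteq> {topspace X}"
    using space(2) connected_space_iff_components_subset_singleton connected_components_of_subset_sing by blast
  finally show ?thesis using finite_subset by blast
next
  case False
  have frontier: "X frontier_of surface \<subseteq> seam"
  proof
    fix x assume x: "x \<in> X frontier_of surface"
    then have xM: "x \<in> surface" using frontier_of_subset_closedin[OF closedin_surface] by blast
    have "x \<notin> X interior_of surface" using x by (simp add: frontier_of_def)
    moreover have "openin X (topspace X - (\<Union>C\<in>curves. N C))"
      by (intro openin_diff openin_topspace closedin_Union_neighbourhoods)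
    then have "topspace X - (\<Union>C\<in>curves. N C) \<subseteq> X interior_of surface"
      unfolding complementary_surface_def by (intro interior_of_maximal closure_of_subset) auto
    ultimately have "x \<in> (\<Union>C\<in>curves. N C)" using xM by (auto simp: surface_eq)
    then show "x \<in> seam" using xM surface_Int_neighbourhoods by blast
  qed
  have "\<exists>S\<in>edges X X1 N. S \<subseteq> W" if W: "W \<in> white_vertices X X1 N" for W
  proof -
    have "W \<inter> X frontier_of surface \<noteq> {}"
      using boundary_bumping_theorem_closed[OF space(2,1,3) closedin_surface False] W
      by (simp add: white_vertices_def components_in_def)
    then obtain x where x: "x \<in> W" "x \<in> seam" using frontier by blast
    then obtain S where "S \<in> edges X X1 N" "x \<in> S" using Union_edges by blast
    then show ?thesis using edge_subset_white[OF _ W] x by blast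
  qed
  then obtain s where s: "\<And>W. W \<in> white_vertices X X1 N \<Longrightarrow> s W \<in> edges X X1 N \<and> s W \<subseteq> W" by metis
  have "inj_on s (white_vertices X X1 N)"
  proof (rule inj_onI, rule ccontr)
    fix W W' assume *: "W \<in> white_vertices X X1 N" "W' \<in> white_vertices X X1 N" "s W = s W'" "W \<noteq> W'"
    then have "s W \<subseteq> W \<inter> W'" using s by (metis Int_greatest)
    then show False using white_disjoint[OF *(1,2,4)] edge_facts(3) s[OF *(1)] by blast
  qed
  moreover have "s ` white_vertices X X1 N \<subseteq> edges X X1 N" using s by blast
  ultimately show ?thesis using finite_edges by (rule inj_on_finite)
qed

lemma topspace_eq: "topspace X = \<Union>(white_vertices X X1 N) \<union> (\<Union>C\<in>curves. N C)"
  unfolding Union_white using neighbourhood(2) interior_of_subset by (fastforce simp: surface_eq)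

end

section \<open>The retraction\<close>

locale stratifold_graph = stratifold_with_neighbourhoods X X1 N
  for X :: "'a topology" and X1 :: "'a set" and N :: "'a set \<Rightarrow> 'a set" +
  fixes w b y :: "'a set \<Rightarrow> 'a" and \<alpha> \<beta> :: "'a set \<Rightarrow> 'a set"
  assumes data: "realization_data X X1 N w b y \<alpha> \<beta>"
begin

abbreviation white :: "'a set set" where "white \<equiv> white_vertices X X1 N"
abbreviation seams :: "'a set set" where "seams \<equiv> edges X X1 N"
definition white_star :: "'a set \<Rightarrow> 'a set" where
  "white_star W = insert (w W) (\<Union>(\<alpha> ` {S \<in> seams. S \<subseteq> W}))"
definition black_star :: "'a set \<Rightarrow> 'a set" where
  "black_star C = insert (b C) (\<Union>(\<beta> ` {S \<in> seams. S \<subseteq> N C}))"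

lemma vertex_data:
  shows "C \<in> curves \<Longrightarrow> b C \<in> C" and "W \<in> white \<Longrightarrow> w W \<in> W"
  using data by (auto simp: realization_data_def surface_interior_def)

lemma arcs_meet_in_vertex:
  shows "W \<in> white \<Longrightarrow> S \<in> seams \<Longrightarrow> S' \<in> seams \<Longrightarrow> S \<subseteq> W \<Longrightarrow> S' \<subseteq> W \<Longrightarrow> S \<noteq> S' \<Longrightarrow> \<alpha> S \<inter> \<alpha> S' = {w W}"
    and "C \<in> curves \<Longrightarrow> S \<in> seams \<Longrightarrow> S' \<in> seams \<Longrightarrow> S \<subseteq> N C \<Longrightarrow> S' \<subseteq> N C \<Longrightarrow> S \<noteq> S' \<Longrightarrow> \<beta> S \<inter> \<beta> S' = {b C}"
  using data by (simp_all add: realization_data_def)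

lemma arc_data:
  assumes "S \<in> seams" "W \<in> white" "C \<in> curves" "S \<subseteq> W" "S \<subseteq> N C"
  shows "y S \<in> S" "arc_from_to X (\<alpha> S) (w W) (y S)" "\<alpha> S \<subseteq> W" "\<alpha> S \<inter> surface_boundary X W = {y S}"
    "arc_from_to X (\<beta> S) (y S) (b C)" "\<exists>D \<in> sheets X C (N C). y S \<in> D \<and> \<beta> S \<subseteq> D"
    "\<beta> S \<inter> nbhd_boundary X (N C) = {y S}"
  using data edge_joins[OF assms] assms(1-3) by (simp_all add: realization_data_def)

lemma white_arc:
  assumes W: "W \<in> white" and S: "S \<in> seams" "S \<subseteq> W"
  shows "arc_from_to X (\<alpha> S) (w W) (y S)" "\<alpha> S \<subseteq> W" "\<alpha> S \<inter> seam = {y S}" "y S \<in> S"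
proof -
  obtain C where C: "C \<in> curves" "S \<subseteq> N C" using edge_in_neighbourhood[OF S(1)] .
  note * = arc_data[OF S(1) W C(1) S(2) C(2)]
  show "arc_from_to X (\<alpha> S) (w W) (y S)" "\<alpha> S \<subseteq> W" "y S \<in> S" by (fact *)+
  have "surface_boundary X W = W \<inter> seam"
    using surface_boundary_eq white_facts(4)[OF W] by blast
  then show "\<alpha> S \<inter> seam = {y S}" using *(3,4) by blast
qed

text \<open>The sheets are closures of subsets of \<open>N C\<close>, which is closed; this keeps the arc inside \<open>N C\<close>.\<close>
lemma black_arc:
  assumes C: "C \<in> curves" and S: "S \<in> seams" "S \<subseteq> N C"
  shows "arc_from_to X (\<beta> S) (b C) (y S)" "\<beta> S \<subseteq> N C" "\<beta> S \<inter> nbhd_boundary X (N C) = {y S}" "y S \<in> S"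
proof -
  obtain W where W: "W \<in> white" "S \<subseteq> W" using edge_in_white[OF S(1)] .
  note * = arc_data[OF S(1) W(1) C W(2) S(2)]
  show "\<beta> S \<inter> nbhd_boundary X (N C) = {y S}" "y S \<in> S" by (fact *)+
  show "arc_from_to X (\<beta> S) (b C) (y S)" using *(5) by (rule arc_from_to_reverse)
  obtain D where D: "D \<in> sheets X C (N C)" "\<beta> S \<subseteq> D" using *(6) by blast
  then obtain K where K: "K \<in> components_in X (N C - C)" "D = X closure_of K"
    by (auto simp: sheets_def)
  have "K \<subseteq> N C" using components_in_facts(2)[OF K(1)] by blast
  then have "D \<subseteq> N C" using K(2) closure_of_minimal closedin_neighbourhood[OF C] by metis
  then show "\<beta> S \<subseteq> N C" using D(2) by blast
qed

lemma star_subset: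
  shows "W \<in> white \<Longrightarrow> white_star W \<subseteq> W" and "C \<in> curves \<Longrightarrow> black_star C \<subseteq> N C"
proof -
  show "white_star W \<subseteq> W" if "W \<in> white"
    using white_arc(2)[OF that] vertex_data(2)[OF that] by (auto simp: white_star_def)
  show "black_star C \<subseteq> N C" if "C \<in> curves"
    using black_arc(2)[OF that] vertex_data(1)[OF that] curve_subset_neighbourhood[OF that]
    by (auto simp: black_star_def)
qed

lemma white_retraction:
  assumes W: "W \<in> white"
  shows "\<exists>r. continuous_map (subtopology X W) X r \<and> r ` W \<subseteq> white_star W \<and>
    (\<forall>x \<in> white_star W. r x = x) \<and> (\<forall>S\<in>{S \<in> seams. S \<subseteq> W}. \<forall>x\<in>S. r x = y S)"
  unfolding white_star_def
proof (rule star_retraction_closedin[OF space(1,3) white_facts(1)[OF W]])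
  let ?E = "{S \<in> seams. S \<subseteq> W}"
  have arc: "arc_from_to X (\<alpha> S) (w W) (y S)" "\<alpha> S \<subseteq> W" "\<alpha> S \<inter> seam = {y S}" "y S \<in> S" if "S \<in> ?E" for S
    using white_arc[OF W] that by blast+
  show "finite ?E" using finite_edges by simp
  show "w W \<in> W" using vertex_data(2)[OF W] .
  fix S assume S: "S \<in> ?E"
  show "arc_from_to X (\<alpha> S) (w W) (y S)" "\<alpha> S \<subseteq> W" using arc[OF S] by auto
  show "closedin X S" "S \<subseteq> W" using S edge_facts(1) by auto
  have "S \<subseteq> seam" using S edge_facts(2) by auto
  then show "\<alpha> S \<inter> S = {y S}" using arc(3,4)[OF S] by auto
  fix S' assume S': "S' \<in> ?E" "S \<noteq> S'"
  show "\<alpha> S \<inter> \<alpha> S' = {w W}" using arcs_meet_in_vertex(1)[OF W] S S' by blast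
  show dis: "S \<inter> S' = {}" using edges_disjoint S S' by blast
  have "S' \<subseteq> seam" using S' edge_facts(2) by auto
  then have "\<alpha> S \<inter> S' \<subseteq> {y S}" using arc(3)[OF S] by auto
  moreover have "y S \<notin> S'" using arc(4)[OF S] dis by auto
  ultimately show "\<alpha> S \<inter> S' = {}" by auto
qed

text \<open>The edges in \<open>N C\<close> lie in its manifold boundary, so the condition on the boundary
  keeps \<open>\<beta> S\<close> away from every edge other than \<open>S\<close>.\<close>
lemma black_retraction:
  assumes C: "C \<in> curves"
  shows "\<exists>r. continuous_map (subtopology X (N C)) X r \<and> r ` N C \<subseteq> black_star C \<and>
    (\<forall>x \<in> black_star C. r x = x) \<and> (\<forall>S\<in>{S \<in> seams. S \<subseteq> N C}. \<forall>x\<in>S. r x = y S)"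
  unfolding black_star_def
proof (rule star_retraction_closedin[OF space(1,3) closedin_neighbourhood[OF C]])
  let ?E = "{S \<in> seams. S \<subseteq> N C}"
  have arc: "arc_from_to X (\<beta> S) (b C) (y S)" "\<beta> S \<subseteq> N C" "\<beta> S \<inter> nbhd_boundary X (N C) = {y S}" "y S \<in> S"
    if "S \<in> ?E" for S
    using black_arc[OF C] that by blast+
  have bd: "S \<subseteq> nbhd_boundary X (N C)" if "S \<in> ?E" for S
  proof -
    have "S \<subseteq> surface \<inter> N C" using that edge_facts(2)[of S] seam_subset(1) by blast
    then show ?thesis
      using surface_Int_neighbourhood[OF C] frontier_subset_nbhd_boundary[OF C] by blast
  qed
  show "finite ?E" using finite_edges by simp
  show "b C \<in> N C" using vertex_data(1)[OF C] curve_subset_neighbourhood[OF C] by blast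
  fix S assume S: "S \<in> ?E"
  show "arc_from_to X (\<beta> S) (b C) (y S)" "\<beta> S \<subseteq> N C" using arc[OF S] by auto
  show "closedin X S" "S \<subseteq> N C" using S edge_facts(1) by auto
  show "\<beta> S \<inter> S = {y S}" using arc(3,4)[OF S] bd[OF S] by auto
  fix S' assume S': "S' \<in> ?E" "S \<noteq> S'"
  show "\<beta> S \<inter> \<beta> S' = {b C}" using arcs_meet_in_vertex(2)[OF C] S S' by blast
  show dis: "S \<inter> S' = {}" using edges_disjoint S S' by blast
  have "\<beta> S \<inter> S' \<subseteq> {y S}" using arc(3)[OF S] bd[OF S'(1)] by auto
  moreover have "y S \<notin> S'" using arc(4)[OF S] dis by auto
  ultimately show "\<beta> S \<inter> S' = {}" by auto
qed

lemma realized_graph_eq: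
  "realized_graph X X1 N w b \<alpha> \<beta> = (\<Union>W\<in>white. white_star W) \<union> (\<Union>C\<in>curves. black_star C)"
proof
  show "realized_graph X X1 N w b \<alpha> \<beta> \<subseteq> (\<Union>W\<in>white. white_star W) \<union> (\<Union>C\<in>curves. black_star C)"
  proof
    fix x assume "x \<in> realized_graph X X1 N w b \<alpha> \<beta>"
    then consider "x \<in> w ` white" | "x \<in> b ` curves" | S where "S \<in> seams" "x \<in> \<alpha> S \<union> \<beta> S"
      by (auto simp: realized_graph_def)
    then show "x \<in> (\<Union>W\<in>white. white_star W) \<union> (\<Union>C\<in>curves. black_star C)"
    proof cases
      case 3
      obtain W where "W \<in> white" "S \<subseteq> W" using edge_in_white[OF 3(1)] .
      moreover obtain C where "C \<in> curves" "S \<subseteq> N C" using edge_in_neighbourhood[OF 3(1)] .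
      ultimately show ?thesis using 3 unfolding white_star_def black_star_def by blast
    qed (auto simp: white_star_def black_star_def)
  qed
  show "(\<Union>W\<in>white. white_star W) \<union> (\<Union>C\<in>curves. black_star C) \<subseteq> realized_graph X X1 N w b \<alpha> \<beta>"
    by (auto simp: realized_graph_def white_star_def black_star_def)
qed

text \<open>The pieces are indexed by a disjoint sum so that the gluing is a single use of the pasting lemma
  for finite closed covers. Two pieces of different kinds meet in edges, where both retractions take
  the value \<open>y S\<close>; two pieces of the same kind are disjoint.\<close>
lemma realized_graph_retract: "realized_graph X X1 N w b \<alpha> \<beta> retract_of_space X"
proof -
  let ?G = "realized_graph X X1 N w b \<alpha> \<beta>"
  obtain rW where rW: "\<forall>W\<in>white. continuous_map (subtopology X W) X (rW W) \<and> rW W ` W \<subseteq> white_star W \<and>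
      (\<forall>x \<in> white_star W. rW W x = x) \<and> (\<forall>S\<in>{S \<in> seams. S \<subseteq> W}. \<forall>x\<in>S. rW W x = y S)"
    using bchoice[OF ballI[OF white_retraction]] by (rule exE)
  obtain rC where rC: "\<forall>C\<in>curves. continuous_map (subtopology X (N C)) X (rC C) \<and> rC C ` N C \<subseteq> black_star C \<and>
      (\<forall>x \<in> black_star C. rC C x = x) \<and> (\<forall>S\<in>{S \<in> seams. S \<subseteq> N C}. \<forall>x\<in>S. rC C x = y S)"
    using bchoice[OF ballI[OF black_retraction]] by (rule exE)
  let ?I = "Inl ` white \<union> Inr ` curves :: ('a set + 'a set) set"
  let ?T = "case_sum (\<lambda>W. W) N :: 'a set + 'a set \<Rightarrow> 'a set"
  let ?f = "case_sum rW rC"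
  have seam_agree: "rW W x = rC C x" if "W \<in> white" "C \<in> curves" "x \<in> W" "x \<in> N C" for W C x
  proof -
    have "x \<in> seam" using white_Int_neighbourhood[OF that(1,2)] that(3,4) by blast
    then obtain S where S: "S \<in> seams" "x \<in> S" using Union_edges by blast
    have "S \<subseteq> W" using edge_subset_white[OF S(1) that(1) S(2) that(3)] .
    moreover have "S \<subseteq> N C" using edge_subset_neighbourhood[OF S(1) that(2) S(2) that(4)] .
    ultimately show ?thesis using bspec[OF rW that(1)] bspec[OF rC that(2)] S by simp
  qed
  obtain r where r: "continuous_map X X r"
    "\<And>x i. \<lbrakk>i \<in> ?I; x \<in> topspace X \<inter> ?T i\<rbrakk> \<Longrightarrow> r x = ?f i x"
  proof (rule pasting_lemma_exists_closed[of ?I X ?T X ?f])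
    show "finite ?I" using finite_white_vertices space(5) by simp
    show "topspace X \<subseteq> \<Union> (?T ` ?I)"
      unfolding topspace_eq by (auto simp: image_Un image_image)
    show "closedin X (?T i)" if "i \<in> ?I" for i
      using that white_facts(1) closedin_neighbourhood by auto
    show "continuous_map (subtopology X (?T i)) X (?f i)" if "i \<in> ?I" for i
      using that rW rC by auto
    show "?f i x = ?f j x" if ij: "i \<in> ?I" "j \<in> ?I" "x \<in> topspace X \<inter> ?T i \<inter> ?T j" for i j x
    proof -
      consider W W' where "i = Inl W" "j = Inl W'" "W \<in> white" "W' \<in> white"
        | W C where "i = Inl W" "j = Inr C" "W \<in> white" "C \<in> curves"
        | W C where "i = Inr C" "j = Inl W" "W \<in> white" "C \<in> curves"
        | C C' where "i = Inr C" "j = Inr C'" "C \<in> curves" "C' \<in> curves"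
        using ij(1,2) by blast
      then show ?thesis
      proof cases
        case 1 then show ?thesis using ij(3) white_disjoint[of W W'] by auto
      next
        case 2 then show ?thesis using ij(3) seam_agree by auto
      next
        case 3 then show ?thesis using ij(3) seam_agree by auto
      next
        case 4 then show ?thesis using ij(3) neighbourhoods_disjoint[of C C'] by auto
      qed
    qed
  qed blast
  have on_white: "r x = rW W x" if "W \<in> white" "x \<in> W" for W x
    using r(2)[of "Inl W" x] that topspace_eq by auto
  have on_black: "r x = rC C x" if "C \<in> curves" "x \<in> N C" for C x
    using r(2)[of "Inr C" x] that topspace_eq by auto
  show ?thesis
    unfolding retract_of_space_def
  proof (intro conjI exI[of _ r] ballI)
    show "?G \<subseteq> topspace X"
      unfolding realized_graph_eq topspace_eq using star_subset by blast
    have "r x \<in> ?G" if "x \<in> topspace X" for x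
    proof -
      have "x \<in> \<Union>white \<union> (\<Union>C\<in>curves. N C)" using that topspace_eq by simp
      then consider W where "W \<in> white" "x \<in> W" | C where "C \<in> curves" "x \<in> N C"
        by auto
      then show ?thesis
      proof cases
        case 1
        then have "rW W x \<in> white_star W" using bspec[OF rW 1(1)] by blast
        then show ?thesis using on_white[OF 1] 1(1) unfolding realized_graph_eq by (intro UnI1 UN_I) simp_all
      next
        case 2
        then have "rC C x \<in> black_star C" using bspec[OF rC 2(1)] by blast
        then show ?thesis using on_black[OF 2] 2(1) unfolding realized_graph_eq by (intro UnI2 UN_I) simp_all
      qed
    qed
    then show "continuous_map X (subtopology X ?G) r"
      using r(1) by (auto simp: continuous_map_in_subtopology)
    show "r x = x" if xG: "x \<in> ?G" for x
    proof -
      consider W where "W \<in> white" "x \<in> white_star W" | C where "C \<in> curves" "x \<in> black_star C"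
        using xG unfolding realized_graph_eq by (elim UnE UN_E) 
      then show ?thesis
      proof cases
        case 1
        then have "x \<in> W" using star_subset(1)[OF 1(1)] by auto
        then show ?thesis using on_white[OF 1(1)] bspec[OF rW 1(1)] 1(2) by simp
      next
        case 2
        then have "x \<in> N C" using star_subset(2)[OF 2(1)] by auto
        then show ?thesis using on_black[OF 2(1)] bspec[OF rC 2(1)] 2(2) by simp
      qed
    qed
  qed
qed

end

theorem lemma1:
  fixes X :: "'a topology" and X1 :: "'a set"
    and N :: "'a set \<Rightarrow> 'a set"
    and w b y :: "'a set \<Rightarrow> 'a" and \<alpha> \<beta> :: "'a set \<Rightarrow> 'a set"
  assumes "two_stratifold X X1"
    and "regular_neighbourhoods X X1 N"
    and "realization_data X X1 N w b y \<alpha> \<beta>"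
  shows "realized_graph X X1 N w b \<alpha> \<beta> retract_of_space X"
proof -
  interpret stratifold_graph X X1 N w b y \<alpha> \<beta>
    using assms by unfold_locales
  show ?thesis by (rule realized_graph_retract)
qed

end
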